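(* Let $f:\{0,1\}^n\times\{0,1\}^n\to\{-1,1\}$ be a total Boolean function. Then $BQC(f)=\Omega(H(\sigma^2(f))/\log n)$. Moreover, for $k\ge1$ let $\kappa_k=\sigma_1(f)+\cdots+\sigma_k(f)$. Then (asymptotically): if $\kappa_k\ge\Omega(\sqrt{k})$, then $BQC(f)=\Omega(\log\kappa_k)$; if $\kappa_k\le O(\sqrt{k})$, then \[BQC(f)=\Omega\!\left(\frac{\log\kappa_k}{\log(\sqrt{k})-\log\kappa_k+1}\right).\]
   Context: $M_f$ is the $2^n\times2^n$ matrix with entry $f(x,y)/2^n$ in row $x$, column $y$. $\sigma_1(f)\ge\sigma_2(f)\ge\cdots\ge\sigma_{2^n}(f)$ are the singular values of $M_f$ (their squares sum to 1), $\sigma^2(f)$ is the vector of their squares, and $H(\sigma^2(f))=-\sum_i\sigma_i(f)^2\log\sigma_i(f)^2$ (base 2, $0\log0=0$). Quantum communication model (Yao, no prior entanglement): Alice receives $x$, Bob $y$; each holds private qubits initialized to the input and $|0\rangle$; in each round one player applies a unitary to his qubits and sends one qubit; at the end a qubit is measured giving the output; cost is the number of qubits exchanged. $BQC(f)$ is the minimum cost of a protocol computing $f$ with error probability at most $1/3$ on every input. *)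

theory Defs
  imports "Jordan_Normal_Form.Char_Poly" "HOL-Library.Multiset"
begin

text \<open>Inputs x,y in {0,1}^n are encoded as natural numbers x,y < 2^n (bit i of x is the
  i-th input bit). f :: nat => nat => real is the Boolean function, only its values on
  x,y < 2^n matter.\<close>

definition Mf :: "nat \<Rightarrow> (nat \<Rightarrow> nat \<Rightarrow> real) \<Rightarrow> real mat" where
  "Mf n f = mat (2^n) (2^n) (\<lambda>(x,y). f x y / 2^n)"

text \<open>Squares of the singular values, with multiplicity: the eigenvalues
  (roots of the characteristic polynomial, with algebraic multiplicity) of M^T M.\<close>
definition sv2 :: "nat \<Rightarrow> (nat \<Rightarrow> nat \<Rightarrow> real) \<Rightarrow> real multiset" where
  "sv2 n f = proots (char_poly (transpose_mat (Mf n f) * Mf n f))"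

definition sv2_list :: "nat \<Rightarrow> (nat \<Rightarrow> nat \<Rightarrow> real) \<Rightarrow> real list" where
  "sv2_list n f = rev (sorted_list_of_multiset (sv2 n f))"

text \<open>sigma_i(f) for i = 1 .. 2^n (1-based indexing as in the paper).\<close>
definition sigma :: "nat \<Rightarrow> (nat \<Rightarrow> nat \<Rightarrow> real) \<Rightarrow> nat \<Rightarrow> real" where
  "sigma n f i = sqrt (sv2_list n f ! (i - 1))"

definition kappa :: "nat \<Rightarrow> (nat \<Rightarrow> nat \<Rightarrow> real) \<Rightarrow> nat \<Rightarrow> real" where
  "kappa n f k = (\<Sum>i=1..k. sigma n f i)"

definition entropy_sv :: "nat \<Rightarrow> (nat \<Rightarrow> nat \<Rightarrow> real) \<Rightarrow> real" where
  "entropy_sv n f = - (\<Sum>\<^sub># (image_mset (\<lambda>l. if l = 0 then 0 else l * log 2 l) (sv2 n f)))"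

section \<open>Quantum communication protocols (Yao model, no prior entanglement)\<close>

text \<open>An m-qubit system has computational basis states b :: nat => bool with b i = False
  for i >= m. States are complex amplitude functions on basis states, operators are
  complex kernels K b b'.\<close>

definition basis :: "nat \<Rightarrow> (nat \<Rightarrow> bool) set" where
  "basis m = {b. \<forall>i\<ge>m. \<not> b i}"

type_synonym qstate = "(nat \<Rightarrow> bool) \<Rightarrow> complex"
type_synonym qop = "(nat \<Rightarrow> bool) \<Rightarrow> (nat \<Rightarrow> bool) \<Rightarrow> complex"

definition apply_op :: "nat \<Rightarrow> qop \<Rightarrow> qstate \<Rightarrow> qstate" where
  "apply_op m K \<psi> = (\<lambda>b. \<Sum>b'\<in>basis m. K b b' * \<psi> b')"

text \<open>K is unitary on the 2^m dimensional space (U^* U = I; in finite dimension this is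
  equivalent to unitarity).\<close>
definition unitary_op :: "nat \<Rightarrow> qop \<Rightarrow> bool" where
  "unitary_op m K \<longleftrightarrow> (\<forall>b1\<in>basis m. \<forall>b2\<in>basis m.
      (\<Sum>b\<in>basis m. cnj (K b b1) * K b b2) = (if b1 = b2 then 1 else 0))"

definition restr :: "(nat \<Rightarrow> bool) \<Rightarrow> nat set \<Rightarrow> nat \<Rightarrow> bool" where
  "restr b S = (\<lambda>i. if i \<in> S then b i else False)"

text \<open>K acts only on the qubits in S, i.e. K = L (x) Id.\<close>
definition local_op :: "nat \<Rightarrow> nat set \<Rightarrow> qop \<Rightarrow> bool" where
  "local_op m S K \<longleftrightarrow> (\<exists>L :: qop. \<forall>b\<in>basis m. \<forall>b'\<in>basis m.
      K b b' = (if (\<forall>i. i \<notin> S \<longrightarrow> b i = b' i) then L (restr b S) (restr b' S) else 0))"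

text \<open>Ownership: own i = True means qubit i is held by Alice, False by Bob.
  A round (p, K, q): player p applies the unitary K to the qubits he holds and then
  sends his qubit q to the other player.\<close>
type_synonym round = "bool \<times> qop \<times> nat"

fun valid_rounds :: "nat \<Rightarrow> (nat \<Rightarrow> bool) \<Rightarrow> round list \<Rightarrow> bool" where
  "valid_rounds m own [] = True"
| "valid_rounds m own ((p, K, q) # rs) \<longleftrightarrow>
     unitary_op m K \<and> local_op m {i. i < m \<and> own i = p} K \<and> q < m \<and> own q = p \<and>
     valid_rounds m (own(q := \<not> p)) rs"

fun final_owner :: "(nat \<Rightarrow> bool) \<Rightarrow> round list \<Rightarrow> nat \<Rightarrow> bool" where
  "final_owner own [] = own"
| "final_owner own ((p, K, q) # rs) = final_owner (own(q := \<not> p)) rs"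

fun evolve :: "nat \<Rightarrow> round list \<Rightarrow> qstate \<Rightarrow> qstate" where
  "evolve m [] \<psi> = \<psi>"
| "evolve m ((p, K, q) # rs) \<psi> = evolve m rs (apply_op m K \<psi>)"

text \<open>A protocol: m qubits in total; qubits 0..n-1 hold Alice's input x, qubits n..2n-1
  hold Bob's input y, qubits 2n..m-1 are ancillas initialized to |0>, distributed between
  the players by own0; a list of rounds; at the end the holder p of the output qubit
  may apply a last local unitary Kf and measures qubit out in the computational basis.\<close>
record protocol =
  nqubits :: nat
  own0 :: "nat \<Rightarrow> bool"
  rounds :: "round list"
  fin_player :: bool
  fin_op :: qop
  out_qubit :: nat

definition valid_protocol :: "nat \<Rightarrow> protocol \<Rightarrow> bool" where
  "valid_protocol n P \<longleftrightarrow>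
     (let m = nqubits P; own' = final_owner (own0 P) (rounds P) in
      2 * n \<le> m \<and> (\<forall>i<n. own0 P i) \<and> (\<forall>i. n \<le> i \<and> i < 2 * n \<longrightarrow> \<not> own0 P i) \<and>
      valid_rounds m (own0 P) (rounds P) \<and>
      unitary_op m (fin_op P) \<and> local_op m {i. i < m \<and> own' i = fin_player P} (fin_op P) \<and>
      out_qubit P < m \<and> own' (out_qubit P) = fin_player P)"

definition init_basis :: "nat \<Rightarrow> nat \<Rightarrow> nat \<Rightarrow> nat \<Rightarrow> bool" where
  "init_basis n x y = (\<lambda>i. if i < n then bit x i else if i < 2 * n then bit y (i - n) else False)"

definition init_state :: "nat \<Rightarrow> nat \<Rightarrow> nat \<Rightarrow> qstate" where
  "init_state n x y = (\<lambda>b. if b = init_basis n x y then 1 else 0)"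

definition final_state :: "nat \<Rightarrow> protocol \<Rightarrow> nat \<Rightarrow> nat \<Rightarrow> qstate" where
  "final_state n P x y =
     apply_op (nqubits P) (fin_op P) (evolve (nqubits P) (rounds P) (init_state n x y))"

definition prob_out :: "nat \<Rightarrow> protocol \<Rightarrow> nat \<Rightarrow> nat \<Rightarrow> bool \<Rightarrow> real" where
  "prob_out n P x y c =
     (\<Sum>b\<in>{b \<in> basis (nqubits P). b (out_qubit P) = c}. (cmod (final_state n P x y b))\<^sup>2)"

text \<open>Measurement outcome c encodes the value (-1)^c, i.e. True means -1.
  The protocol computes f with error at most 1/3 on every input.\<close>
definition computes :: "nat \<Rightarrow> (nat \<Rightarrow> nat \<Rightarrow> real) \<Rightarrow> protocol \<Rightarrow> bool" where
  "computes n f P \<longleftrightarrow> valid_protocol n P \<and>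
     (\<forall>x<2^n. \<forall>y<2^n. prob_out n P x y (f x y = -1) \<ge> 2/3)"

definition BQC :: "nat \<Rightarrow> (nat \<Rightarrow> nat \<Rightarrow> real) \<Rightarrow> nat" where
  "BQC n f = (LEAST c. \<exists>P. computes n f P \<and> length (rounds P) = c)"

definition boolean_fun :: "nat \<Rightarrow> (nat \<Rightarrow> nat \<Rightarrow> real) \<Rightarrow> bool" where
  "boolean_fun n f \<longleftrightarrow> (\<forall>x<2^n. \<forall>y<2^n. f x y = 1 \<or> f x y = -1)"

end

theory Submission
  imports Defs "HOL-Analysis.L2_Norm"
begin

text \<open>
  After \<open>c\<close> qubits of communication the joint final state is a sum of \<open>2^c\<close> products of a vector
  depending only on Alice's input and a vector depending only on Bob's (Yao, Kremer). Hence the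
  matrices of output probabilities have complex rank at most \<open>4^c\<close>. Applying the
  majority-of-\<open>(2m+1)\<close> polynomial entrywise to these matrices reduces the error to \<open>2 (8/9)^m\<close> and
  raises the rank only to \<open>2^O(c m)\<close>. So \<open>M_f\<close> is within \<open>e = 2 (8/9)^m\<close> in Frobenius norm of a
  matrix of rank \<open>r = 2^O(c m)\<close>, and by Eckart-Young the squared singular values beyond the first
  \<open>r\<close> sum to at most \<open>e^2\<close>. Hence the entropy is at most \<open>log r + (n + 2) e^2 + 4 e\<close>, which is
  \<open>O(c log n)\<close> for \<open>m\<close> of order \<open>log n\<close>. For \<open>\<kappa>_k\<close>, Cauchy-Schwarz on head and tail gives
  \<open>\<kappa>_k \<le> sqrt r + sqrt k * e\<close>, and \<open>m\<close> of order \<open>log (sqrt k / \<kappa>_k) + 1\<close> makes the second term at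
  most \<open>\<kappa>_k / 2\<close>. All additive constants are absorbed when \<open>c \<ge> 1\<close>. When \<open>c = 0\<close> the matrix \<open>M_f\<close>
  has rank one, and both bounds apply with \<open>r = 1\<close> and \<open>e = 0\<close>.
\<close>

section \<open>The spectral theorem for real symmetric matrices\<close>

lemma hermitian_eigenvalue_real:
  fixes A :: "complex mat"
  assumes A: "A \<in> carrier_mat n n" and herm: "\<And>i j. i < n \<Longrightarrow> j < n \<Longrightarrow> A $$ (j, i) = cnj (A $$ (i, j))"
    and a: "eigenvalue A a"
  shows "a \<in> \<real>"
proof -
  obtain v where v: "v \<in> carrier_vec n" "v \<noteq> 0\<^sub>v n" and Av: "A *\<^sub>v v = a \<cdot>\<^sub>v v"
    using a A by (auto simp: eigenvalue_def eigenvector_def)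
  have row_eq: "(\<Sum>j<n. A $$ (i, j) * v $ j) = a * v $ i" if "i < n" for i
    using arg_cong[OF Av, of "\<lambda>w. w $ i"] that A v by (simp add: scalar_prod_def lessThan_atLeast0)
  define R where "R = (\<Sum>i<n. (cmod (v $ i))\<^sup>2)"
  define Q where "Q = (\<Sum>i<n. \<Sum>j<n. cnj (v $ i) * A $$ (i, j) * v $ j)"
  have "Q = (\<Sum>i<n. cnj (v $ i) * (\<Sum>j<n. A $$ (i, j) * v $ j))"
    by (simp add: Q_def sum_distrib_left mult.assoc)
  also have "\<dots> = (\<Sum>i<n. a * (v $ i * cnj (v $ i)))"
    by (intro sum.cong) (simp_all add: row_eq)
  also have "\<dots> = a * of_real R"
    unfolding R_def of_real_sum complex_norm_square by (rule sum_distrib_left[symmetric])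
  finally have Q_eq: "Q = a * of_real R" .
  have "cnj Q = (\<Sum>i<n. \<Sum>j<n. cnj (v $ j) * A $$ (j, i) * v $ i)"
    unfolding Q_def cnj_sum by (intro sum.cong refl) (simp add: mult_ac flip: herm)
  also have "\<dots> = Q"
    unfolding Q_def by (rule sum.swap)
  finally have "cnj a * of_real R = a * of_real R"
    unfolding Q_eq by simp
  moreover have "R \<noteq> 0"
  proof
    assume "R = 0"
    then have "\<forall>i<n. v $ i = 0" by (simp add: R_def sum_nonneg_eq_0_iff)
    then show False using v by auto
  qed
  ultimately show ?thesis by (simp add: Reals_cnj_iff)
qed

lemma real_symmetric_char_poly_splits:
  fixes A :: "real mat"
  assumes A: "A \<in> carrier_mat n n" and sym: "transpose_mat A = A"
  shows "\<exists>es. char_poly A = (\<Prod>e\<leftarrow>es. [:- e, 1:])"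
proof -
  define C where "C = map_mat complex_of_real A"
  have C: "C \<in> carrier_mat n n" using A by (simp add: C_def)
  have herm: "C $$ (j, i) = cnj (C $$ (i, j))" if "i < n" "j < n" for i j
    using arg_cong[OF sym, of "\<lambda>M. M $$ (i, j)"] that A by (simp add: C_def)
  obtain as where as: "char_poly C = (\<Prod>a\<leftarrow>as. [:- a, 1:])"
    using char_poly_factorized[OF C] by blast
  have "a \<in> \<real>" if "a \<in> set as" for a
  proof -
    have "poly (char_poly C) a = 0"
      unfolding as poly_prod_list using that by (auto simp: prod_list_zero_iff)
    then show ?thesis
      using hermitian_eigenvalue_real[OF C herm] eigenvalue_root_char_poly[OF C] by blast
  qed
  then have as_Re: "as = map complex_of_real (map Re as)"
    by (auto simp: o_def intro!: map_idI[symmetric] of_real_Re)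
  interpret h: map_poly_inj_comm_ring_hom complex_of_real ..
  have "map_poly complex_of_real (char_poly A) = char_poly C"
    unfolding C_def by (simp add: of_real_hom.char_poly_hom[OF A])
  also have "\<dots> = map_poly complex_of_real (\<Prod>e\<leftarrow>map Re as. [:- e, 1:])"
    unfolding as by (subst as_Re) (simp add: h.hom_prod_list o_def)
  finally have "char_poly A = (\<Prod>e\<leftarrow>map Re as. [:- e, 1:])" by (rule h.injectivity)
  then show ?thesis by blast
qed

definition orthogonal_matrix :: "nat \<Rightarrow> real mat \<Rightarrow> bool" where
  "orthogonal_matrix n U \<longleftrightarrow> U \<in> carrier_mat n n \<and> transpose_mat U * U = 1\<^sub>m n"

lemma orthogonal_matrixD:
  assumes "orthogonal_matrix n U"
  shows "U \<in> carrier_mat n n" "transpose_mat U * U = 1\<^sub>m n" "U * transpose_mat U = 1\<^sub>m n"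
proof -
  show U: "U \<in> carrier_mat n n" and left: "transpose_mat U * U = 1\<^sub>m n"
    using assms by (auto simp: orthogonal_matrix_def)
  show "U * transpose_mat U = 1\<^sub>m n"
    using mat_mult_left_right_inverse[OF _ U left] U by simp
qed

lemma orthogonal_matrix_mult:
  assumes "orthogonal_matrix n U" "orthogonal_matrix n V"
  shows "orthogonal_matrix n (U * V)"
proof -
  note U = orthogonal_matrixD[OF assms(1)] and V = orthogonal_matrixD[OF assms(2)]
  have "transpose_mat (U * V) * (U * V) = transpose_mat V * (transpose_mat U * U) * V"
    using U(1) V(1) by (simp add: transpose_mult[of _ n n _ n] assoc_mult_mat[of _ n n _ n _ n])
  then show ?thesis using U V by (simp add: orthogonal_matrix_def)
qed

definition householder :: "nat \<Rightarrow> real vec \<Rightarrow> real mat" where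
  "householder n u = mat n n (\<lambda>(i, j). (if i = j then 1 else 0) - 2 / (u \<bullet> u) * (u $ i * u $ j))"

lemma householder_carrier: "householder n u \<in> carrier_mat n n"
  by (simp add: householder_def)

lemma transpose_householder: "transpose_mat (householder n u) = householder n u"
  by (rule eq_matI) (auto simp: householder_def mult.commute)

lemma householder_involution:
  assumes u: "u \<in> carrier_vec n"
  shows "householder n u * householder n u = 1\<^sub>m n"
proof (rule eq_matI)
  fix i j assume "i < dim_row (1\<^sub>m n)" "j < dim_col (1\<^sub>m n)"
  then have ij: "i < n" "j < n" by auto
  define c where "c = 2 / (u \<bullet> u)"
  have norm: "(\<Sum>k<n. u $ k * u $ k) = u \<bullet> u"
    using u by (simp add: scalar_prod_def lessThan_atLeast0)
  have "(householder n u * householder n u) $$ (i, j)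
      = (\<Sum>k<n. ((if i = k then 1 else 0) - c * (u $ i * u $ k))
          * ((if k = j then 1 else 0) - c * (u $ k * u $ j)))"
    using ij by (simp add: householder_def c_def scalar_prod_def lessThan_atLeast0)
  also have "\<dots> = (\<Sum>k<n. (if k = i then if k = j then 1 else 0 else 0)
      - (if k = i then c * (u $ k * u $ j) else 0) - (if k = j then c * (u $ i * u $ k) else 0)
      + c * c * (u $ i * u $ j) * (u $ k * u $ k))"
    by (intro sum.cong refl) (simp add: algebra_simps)
  also have "\<dots> = (if i = j then 1 else 0) - 2 * c * (u $ i * u $ j)
      + c * c * (u $ i * u $ j) * (u \<bullet> u)"
    using ij by (simp add: sum.distrib sum_subtractf norm flip: sum_distrib_left)
  also have "\<dots> = 1\<^sub>m n $$ (i, j)"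
    using ij by (simp add: c_def)
  finally show "(householder n u * householder n u) $$ (i, j) = 1\<^sub>m n $$ (i, j)" .
qed (auto simp: householder_def)

lemma orthogonal_matrix_householder:
  "u \<in> carrier_vec n \<Longrightarrow> orthogonal_matrix n (householder n u)"
  by (simp add: orthogonal_matrix_def householder_carrier transpose_householder
      householder_involution)

text \<open>The reflection in the hyperplane orthogonal to \<open>v - e\<^sub>0\<close> exchanges the unit vectors \<open>v\<close> and
  \<open>e\<^sub>0\<close>; it is the identity if \<open>v = e\<^sub>0\<close> because \<open>2 / 0 = 0\<close>.\<close>
lemma col_householder:
  assumes v: "v \<in> carrier_vec n" "v \<bullet> v = 1" and n: "0 < n"
  shows "col (householder n (v - unit_vec n 0)) 0 = v"
proof (rule eq_vecI)
  define u where "u = v - unit_vec n 0"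
  have u: "u \<in> carrier_vec n" using v by (simp add: u_def)
  have ui: "u $ i = v $ i - (if i = 0 then 1 else 0)" if "i < n" for i
    using v that by (simp add: u_def)
  have "u \<bullet> u = v \<bullet> v - 2 * v $ 0 + 1"
  proof -
    have "u \<bullet> u = (\<Sum>i<n. v $ i * v $ i + (if i = 0 then 1 - 2 * v $ i else 0))"
      using u unfolding scalar_prod_def
      by (auto simp: lessThan_atLeast0 ui algebra_simps intro!: sum.cong)
    also have "\<dots> = v \<bullet> v + (1 - 2 * v $ 0)"
      using n v by (simp add: sum.distrib scalar_prod_def lessThan_atLeast0)
    finally show ?thesis by simp
  qed
  then have u0: "u \<bullet> u = - 2 * u $ 0" using v n by (simp add: ui)
  fix i assume "i < dim_vec v"
  then have i: "i < n" using v by simp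
  have "col (householder n u) 0 $ i = (if i = 0 then 1 else 0) - 2 / (u \<bullet> u) * (u $ i * u $ 0)"
    using i n by (simp add: householder_def)
  also have "\<dots> = (if i = 0 then 1 else 0) + u $ i"
  proof (cases "u $ 0 = 0")
    case True
    then have "u \<bullet> u = 0" using u0 by simp
    then have "u $ i = 0"
      using u i by (simp add: scalar_prod_def sum_nonneg_eq_0_iff)
    then show ?thesis by simp
  qed (simp add: u0)
  also have "\<dots> = v $ i" by (simp add: ui i)
  finally show "col (householder n (v - unit_vec n 0)) 0 $ i = v $ i" by (simp add: u_def)
qed (use v in \<open>simp add: householder_def\<close>)

lemma eigenvalue_unit_eigenvector:
  fixes A :: "real mat"
  assumes A: "A \<in> carrier_mat n n" and e: "eigenvalue A e"
  obtains v where "v \<in> carrier_vec n" "v \<bullet> v = 1" "A *\<^sub>v v = e \<cdot>\<^sub>v v"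
proof -
  obtain u where u: "u \<in> carrier_vec n" "u \<noteq> 0\<^sub>v n" "A *\<^sub>v u = e \<cdot>\<^sub>v u"
    using e A by (auto simp: eigenvalue_def eigenvector_def)
  have "u \<bullet> u \<noteq> 0"
  proof
    assume "u \<bullet> u = 0"
    then have "\<forall>i<n. u $ i = 0" using u(1) by (simp add: scalar_prod_def sum_nonneg_eq_0_iff)
    then show False using u by auto
  qed
  moreover have "u \<bullet> u \<ge> 0" by (simp add: scalar_prod_def sum_nonneg)
  ultimately have pos: "u \<bullet> u > 0" by simp
  define v where "v = (1 / sqrt (u \<bullet> u)) \<cdot>\<^sub>v u"
  show thesis
  proof
    show "v \<in> carrier_vec n" using u by (simp add: v_def)
    show "v \<bullet> v = 1" using u pos by (simp add: v_def)
    show "A *\<^sub>v v = e \<cdot>\<^sub>v v"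
      using A u by (simp add: v_def mult_mat_vec smult_smult_assoc mult.commute)
  qed
qed

definition bordered :: "'a::zero \<Rightarrow> 'a mat \<Rightarrow> 'a mat" where
  "bordered e D = four_block_mat (mat 1 1 (\<lambda>_. e)) (0\<^sub>m 1 (dim_col D)) (0\<^sub>m (dim_row D) 1) D"

lemma bordered_carrier: "D \<in> carrier_mat k k \<Longrightarrow> bordered e D \<in> carrier_mat (Suc k) (Suc k)"
  by (auto simp: bordered_def)

lemma bordered_one: "bordered 1 (1\<^sub>m k) = 1\<^sub>m (Suc k)"
  by (rule eq_matI) (auto simp: bordered_def)

lemma transpose_bordered: "transpose_mat (bordered e D) = bordered e (transpose_mat D)"
  by (rule eq_matI) (auto simp: bordered_def)

lemma bordered_mult:
  fixes D E :: "'a::semiring_1 mat"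
  assumes "D \<in> carrier_mat k k" "E \<in> carrier_mat k k"
  shows "bordered d D * bordered e E = bordered (d * e) (D * E)"
proof -
  have "mat 1 1 (\<lambda>_. d) * mat 1 1 (\<lambda>_. e) = mat 1 1 (\<lambda>_. d * e)"
    by (rule eq_matI) (auto simp: scalar_prod_def)
  then show ?thesis
    using assms unfolding bordered_def
    by (subst mult_four_block_mat[of _ 1 1 _ k _ k _ _ 1 _ k]) auto
qed

lemma mat_diag_Suc: "mat_diag (Suc k) l = bordered (l 0) (mat_diag k (\<lambda>i. l (Suc i)))"
  by (rule eq_matI) (auto simp: mat_diag_def bordered_def)

lemma char_poly_bordered:
  fixes D :: "'a::field mat"
  assumes "D \<in> carrier_mat k k"
  shows "char_poly (bordered e D) = [:- e, 1:] * char_poly D"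
proof -
  have "char_poly (mat 1 1 (\<lambda>_. e)) = [:- e, 1:]"
    by (simp add: char_poly_defs det_def sign_def)
  then show ?thesis
    using char_poly_four_block_zeros_col[of "mat 1 1 (\<lambda>_. e)" "0\<^sub>m 1 k" k D] assms
    by (auto simp: bordered_def)
qed

lemma symmetric_eq_bordered:
  assumes B: "B \<in> carrier_mat (Suc k) (Suc k)" "transpose_mat B = B"
    and col_B: "col B 0 = e \<cdot>\<^sub>v unit_vec (Suc k) 0"
  obtains D where "D \<in> carrier_mat k k" "transpose_mat D = D" "B = bordered (e :: real) D"
proof
  define D where "D = mat k k (\<lambda>(i, j). B $$ (Suc i, Suc j))"
  have B_sym: "B $$ (i, j) = B $$ (j, i)" if "i < Suc k" "j < Suc k" for i j
    using that B by (metis carrier_matD index_transpose_mat(1))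
  have B_0: "B $$ (i, 0) = (if i = 0 then e else 0)" if "i < Suc k" for i
    using arg_cong[OF col_B, of "\<lambda>w. w $ i"] that B(1) by simp
  show "D \<in> carrier_mat k k" by (simp add: D_def)
  show "transpose_mat D = D" by (rule eq_matI) (use B_sym in \<open>auto simp: D_def\<close>)
  show "B = bordered e D"
    by (rule eq_matI) (use B(1) B_0 B_sym in \<open>auto simp: D_def bordered_def\<close>)
qed

lemma real_symmetric_deflation:
  fixes A :: "real mat"
  assumes A: "A \<in> carrier_mat (Suc k) (Suc k)" and sym: "transpose_mat A = A"
    and e: "eigenvalue A e"
  obtains H D where "orthogonal_matrix (Suc k) H" "D \<in> carrier_mat k k" "transpose_mat D = D"
    and "A = H * bordered e D * transpose_mat H"
proof -
  obtain v where v: "v \<in> carrier_vec (Suc k)" "v \<bullet> v = 1" and Av: "A *\<^sub>v v = e \<cdot>\<^sub>v v"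
    using eigenvalue_unit_eigenvector[OF A e] by blast
  define u where "u = v - unit_vec (Suc k) 0"
  have u: "u \<in> carrier_vec (Suc k)" using v by (simp add: u_def)
  define H where "H = householder (Suc k) u"
  have H: "H \<in> carrier_mat (Suc k) (Suc k)" "transpose_mat H = H" "H * H = 1\<^sub>m (Suc k)"
    by (simp_all add: H_def householder_carrier transpose_householder householder_involution[OF u])
  have col_H: "col H 0 = v" using col_householder[OF v] by (simp add: H_def u_def)
  define B where "B = H * A * H"
  note assoc = assoc_mult_mat[of _ "Suc k" "Suc k" _ "Suc k" _ "Suc k"]
    and carrier = mult_carrier_mat[of _ "Suc k" "Suc k" _ "Suc k"]
  have "col B 0 = (H * A) *\<^sub>v v"
    unfolding B_def col_H[symmetric] by (rule col_mult2[OF mult_carrier_mat[OF H(1) A] H(1)]) simp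
  also have "\<dots> = H *\<^sub>v (A *\<^sub>v v)" by (rule assoc_mult_mat_vec[OF H(1) A v(1)])
  also have "\<dots> = e \<cdot>\<^sub>v (H *\<^sub>v v)" unfolding Av by (rule mult_mat_vec[OF H(1) v(1)])
  also have "H *\<^sub>v v = col (H * H) 0"
    unfolding col_H[symmetric] by (rule col_mult2[OF H(1) H(1), symmetric]) simp
  also have "\<dots> = unit_vec (Suc k) 0" unfolding H(3) by simp
  finally have "col B 0 = e \<cdot>\<^sub>v unit_vec (Suc k) 0" .
  moreover have "B \<in> carrier_mat (Suc k) (Suc k)" using H A by (simp add: B_def)
  moreover have "transpose_mat B = B"
    unfolding B_def using H A sym
    by (simp add: transpose_mult[of _ "Suc k" "Suc k" _ "Suc k"] assoc carrier)
  ultimately obtain D where D: "D \<in> carrier_mat k k" "transpose_mat D = D" "B = bordered e D"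
    using symmetric_eq_bordered by blast
  have "H * B * H = (H * H) * A * (H * H)"
    unfolding B_def using H(1) A by (simp add: assoc carrier)
  then have "A = H * bordered e D * transpose_mat H"
    using A by (simp add: H(2,3) flip: D(3))
  with D(1,2) show thesis
    by (intro that[of H D]) (simp_all add: H_def orthogonal_matrix_householder u)
qed

lemma orthogonal_matrix_bordered:
  "orthogonal_matrix k V \<Longrightarrow> orthogonal_matrix (Suc k) (bordered 1 V)"
  by (simp add: orthogonal_matrix_def bordered_carrier transpose_bordered bordered_mult[of _ k]
      bordered_one)

lemma bordered_diagonalization:
  assumes "orthogonal_matrix k V"
  shows "bordered (l 0) (V * mat_diag k (\<lambda>i. l (Suc i)) * transpose_mat V)
    = bordered 1 V * mat_diag (Suc k) l * transpose_mat (bordered 1 V)"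
  using orthogonal_matrixD(1)[OF assms]
  by (simp add: mat_diag_Suc transpose_bordered bordered_mult[of _ k] mult_carrier_mat[of _ k k])

lemma char_poly_orthogonal_conjugate:
  assumes U: "orthogonal_matrix n U" and B: "B \<in> carrier_mat n n"
  shows "char_poly (U * B * transpose_mat U) = char_poly B"
proof -
  have "similar_mat_wit (U * B * transpose_mat U) B U (transpose_mat U)"
    by (rule similar_mat_witI[of _ _ n]) (use orthogonal_matrixD[OF U] B in auto)
  then show ?thesis by (intro char_poly_similar) (auto simp: similar_mat_def)
qed

theorem real_symmetric_spectral:
  fixes A :: "real mat"
  assumes "A \<in> carrier_mat n n" "transpose_mat A = A" "char_poly A = (\<Prod>e\<leftarrow>es. [:- e, 1:])"
  shows "\<exists>U. orthogonal_matrix n U \<and> A = U * mat_diag n ((!) es) * transpose_mat U"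
  using assms
proof (induction es arbitrary: n A)
  case Nil
  then have "n = 0" using degree_monic_char_poly[of A n] by auto
  then show ?case
    using Nil by (intro exI[of _ "1\<^sub>m 0"]) (auto simp: orthogonal_matrix_def)
next
  case (Cons e es n A)
  note A = Cons.prems(1)
  define k where "k = length es"
  have n: "n = Suc k"
    using degree_monic_char_poly[OF A] degree_linear_factors[of uminus "e # es"] Cons.prems(3)
    by (simp add: k_def)
  have char_A: "char_poly A = [:- e, 1:] * (\<Prod>e\<leftarrow>es. [:- e, 1:])" using Cons.prems(3) by simp
  have "eigenvalue A e"
    unfolding eigenvalue_root_char_poly[OF A] char_A by simp
  then obtain H D where H: "orthogonal_matrix n H"
    and D: "D \<in> carrier_mat k k" "transpose_mat D = D"
    and A_eq: "A = H * bordered e D * transpose_mat H"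
    using real_symmetric_deflation[of A k e] A Cons.prems(2) unfolding n by blast
  have "char_poly A = [:- e, 1:] * char_poly D"
    unfolding A_eq using D(1)
    by (simp add: char_poly_orthogonal_conjugate[OF H] n bordered_carrier char_poly_bordered)
  then have "char_poly D = (\<Prod>e\<leftarrow>es. [:- e, 1:])"
    unfolding char_A by (metis mult_cancel_left pCons_eq_0_iff zero_neq_one)
  from Cons.IH[OF D this] obtain V where V: "orthogonal_matrix k V"
    and D_eq: "D = V * mat_diag k ((!) es) * transpose_mat V" by blast
  let ?G = "bordered 1 V" and ?\<Lambda> = "mat_diag n ((!) (e # es))"
  have G: "orthogonal_matrix n ?G"
    using orthogonal_matrix_bordered[OF V] by (simp add: n)
  have "bordered e D = ?G * ?\<Lambda> * transpose_mat ?G"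
    using bordered_diagonalization[OF V, of "(!) (e # es)"] by (simp add: n flip: D_eq)
  then have "A = (H * ?G) * ?\<Lambda> * transpose_mat (H * ?G)"
    unfolding A_eq using orthogonal_matrixD(1)[OF H] orthogonal_matrixD(1)[OF G]
    by (simp add: transpose_mult[of _ n n _ n] assoc_mult_mat[of _ n n _ n _ n]
        mult_carrier_mat[of _ n n _ n])
  then show ?case using orthogonal_matrix_mult[OF H G] by blast
qed

section \<open>Matrices of bounded rank\<close>

text \<open>A matrix is a function of a row and a column index, and its rank is bounded through the
  number of terms in a sum of outer products.\<close>
definition rank_le :: "'a set \<Rightarrow> 'b set \<Rightarrow> nat \<Rightarrow> ('a \<Rightarrow> 'b \<Rightarrow> 'c::comm_semiring_1) \<Rightarrow> bool" where
  "rank_le X Y r F \<longleftrightarrow> (\<exists>u v. \<forall>x\<in>X. \<forall>y\<in>Y. F x y = (\<Sum>i<r. u i x * v i y))"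

lemma rank_leE:
  assumes "rank_le X Y r F"
  obtains u v where "\<And>x y. x \<in> X \<Longrightarrow> y \<in> Y \<Longrightarrow> F x y = (\<Sum>i<r. u i x * v i y)"
  using assms unfolding rank_le_def by blast

lemma rank_leI:
  assumes "finite I" "card I \<le> r"
    and F: "\<And>x y. x \<in> X \<Longrightarrow> y \<in> Y \<Longrightarrow> F x y = (\<Sum>i\<in>I. u i x * v i y)"
  shows "rank_le X Y r F"
proof -
  obtain h where h: "bij_betw h {..<card I} I"
    using \<open>finite I\<close> by (metis ex_bij_betw_nat_finite atLeast0LessThan)
  define u' where "u' i x = (if i < card I then u (h i) x else 0)" for i x
  have "F x y = (\<Sum>i<r. u' i x * v (h i) y)" if "x \<in> X" "y \<in> Y" for x y
  proof -
    have "F x y = (\<Sum>i<card I. u (h i) x * v (h i) y)"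
      using sum.reindex_bij_betw[OF h, of "\<lambda>i. u i x * v i y"] F[OF that] by simp
    also have "\<dots> = (\<Sum>i<card I. u' i x * v (h i) y)"
      by (simp add: u'_def)
    also have "\<dots> = (\<Sum>i<r. u' i x * v (h i) y)"
      using \<open>card I \<le> r\<close> by (intro sum.mono_neutral_left) (auto simp: u'_def)
    finally show ?thesis .
  qed
  then show ?thesis unfolding rank_le_def by (intro exI[of _ u'] exI[of _ "\<lambda>i. v (h i)"]) blast
qed

lemma rank_le_mono:
  assumes "rank_le X Y r F" "X' \<subseteq> X" "Y' \<subseteq> Y" "r \<le> s"
  shows "rank_le X' Y' s F"
proof -
  obtain u v where "\<And>x y. x \<in> X \<Longrightarrow> y \<in> Y \<Longrightarrow> F x y = (\<Sum>i<r. u i x * v i y)"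
    using rank_leE[OF assms(1)] by blast
  then show ?thesis
    using assms(2-) by (intro rank_leI[of "{..<r}" s X' Y' F u v]) auto
qed

lemma rank_le_transpose:
  assumes "rank_le X Y r F"
  shows "rank_le Y X r (\<lambda>y x. F x y)"
proof -
  obtain u v where "\<And>x y. x \<in> X \<Longrightarrow> y \<in> Y \<Longrightarrow> F x y = (\<Sum>i<r. u i x * v i y)"
    using rank_leE[OF assms] by blast
  then show ?thesis
    by (intro rank_leI[of "{..<r}" r Y X _ v u]) (auto simp: mult.commute)
qed

lemma rank_le_row_combination:
  assumes "rank_le X Y r F" and g: "\<And>x k. x \<in> X' \<Longrightarrow> k \<in> A \<Longrightarrow> g x k \<in> X"
  shows "rank_le X' Y r (\<lambda>x y. \<Sum>k\<in>A. l x k * F (g x k) y)"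
proof -
  obtain u v where F: "\<And>x y. x \<in> X \<Longrightarrow> y \<in> Y \<Longrightarrow> F x y = (\<Sum>i<r. u i x * v i y)"
    using rank_leE[OF assms(1)] by blast
  have "(\<Sum>k\<in>A. l x k * F (g x k) y) = (\<Sum>i<r. (\<Sum>k\<in>A. l x k * u i (g x k)) * v i y)"
    if "x \<in> X'" "y \<in> Y" for x y
  proof -
    have "(\<Sum>k\<in>A. l x k * F (g x k) y) = (\<Sum>k\<in>A. \<Sum>i<r. l x k * u i (g x k) * v i y)"
      using that by (intro sum.cong) (simp_all add: F g sum_distrib_left mult.assoc)
    also have "\<dots> = (\<Sum>i<r. \<Sum>k\<in>A. l x k * u i (g x k) * v i y)" by (rule sum.swap)
    finally show ?thesis by (simp add: sum_distrib_right)
  qed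
  then show ?thesis
    by (intro rank_leI[of "{..<r}" r X' Y _ "\<lambda>i x. \<Sum>k\<in>A. l x k * u i (g x k)" v]) auto
qed

lemma rank_le_col_combination:
  assumes "rank_le X Y r F" and "\<And>y k. y \<in> Y' \<Longrightarrow> k \<in> A \<Longrightarrow> g y k \<in> Y"
  shows "rank_le X Y' r (\<lambda>x y. \<Sum>k\<in>A. l y k * F x (g y k))"
  using rank_le_transpose[OF rank_le_row_combination[OF rank_le_transpose[OF assms(1)] assms(2)]] .

lemma rank_le_outer: "rank_le X Y 1 (\<lambda>x y. u x * v y)"
  by (rule rank_leI[of "{()}" 1 X Y _ "\<lambda>_. u" "\<lambda>_. v"]) auto

lemma rank_le_add:
  assumes "rank_le X Y r F" "rank_le X Y s G"
  shows "rank_le X Y (r + s) (\<lambda>x y. F x y + G x y)"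
proof -
  obtain u v where F: "\<And>x y. x \<in> X \<Longrightarrow> y \<in> Y \<Longrightarrow> F x y = (\<Sum>i<r. u i x * v i y)"
    using rank_leE[OF assms(1)] by blast
  obtain u' v' where G: "\<And>x y. x \<in> X \<Longrightarrow> y \<in> Y \<Longrightarrow> G x y = (\<Sum>i<s. u' i x * v' i y)"
    using rank_leE[OF assms(2)] by blast
  show ?thesis
    by (rule rank_leI[of "{..<r} <+> {..<s}" _ X Y _ "case_sum u u'" "case_sum v v'"])
      (auto simp: F G sum.Plus card_Plus)
qed

lemma rank_le_mult:
  assumes "rank_le X Y r F" "rank_le X Y s G"
  shows "rank_le X Y (r * s) (\<lambda>x y. F x y * G x y)"
proof -
  obtain u v where F: "\<And>x y. x \<in> X \<Longrightarrow> y \<in> Y \<Longrightarrow> F x y = (\<Sum>i<r. u i x * v i y)"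
    using rank_leE[OF assms(1)] by blast
  obtain u' v' where G: "\<And>x y. x \<in> X \<Longrightarrow> y \<in> Y \<Longrightarrow> G x y = (\<Sum>i<s. u' i x * v' i y)"
    using rank_leE[OF assms(2)] by blast
  show ?thesis
  proof (rule rank_leI[of "{..<r} \<times> {..<s}" _ X Y _
        "\<lambda>(i, j) x. u i x * u' j x" "\<lambda>(i, j) y. v i y * v' j y"])
    fix x y assume xy: "x \<in> X" "y \<in> Y"
    have "F x y * G x y = (\<Sum>i<r. \<Sum>j<s. (u i x * v i y) * (u' j x * v' j y))"
      unfolding F[OF xy] G[OF xy] by (rule sum_product)
    then show "F x y * G x y = (\<Sum>k\<in>{..<r} \<times> {..<s}.
        (case k of (i, j) \<Rightarrow> \<lambda>x. u i x * u' j x) x * (case k of (i, j) \<Rightarrow> \<lambda>y. v i y * v' j y) y)"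
      by (simp add: sum.cartesian_product case_prod_unfold mult_ac)
  qed auto
qed

lemma rank_le_sum:
  assumes "finite J" "\<And>j. j \<in> J \<Longrightarrow> rank_le X Y r (F j)"
  shows "rank_le X Y (card J * r) (\<lambda>x y. \<Sum>j\<in>J. F j x y)"
  using assms
proof (induction J rule: finite_induct)
  case empty
  show ?case by (rule rank_leI[of "{}"]) auto
next
  case (insert j J)
  then show ?case using rank_le_add[of X Y r "F j"] by simp
qed

lemma rank_le_cmult: "rank_le X Y r F \<Longrightarrow> rank_le X Y r (\<lambda>x y. c * F x y)"
  using rank_le_mult[OF rank_le_outer[of X Y "\<lambda>_. c" "\<lambda>_. 1"]] by simp

lemma rank_le_power: "rank_le X Y r F \<Longrightarrow> rank_le X Y (r ^ k) (\<lambda>x y. F x y ^ k)"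
proof (induction k)
  case 0
  show ?case using rank_le_outer[of X Y "\<lambda>_. 1" "\<lambda>_. 1"] by simp
next
  case (Suc k)
  then show ?case using rank_le_mult[of X Y r F] by simp
qed

lemma rank_le_poly:
  assumes F: "rank_le X Y r F" and r: "1 \<le> r" and p: "degree p \<le> d"
  shows "rank_le X Y (Suc d * r ^ d) (\<lambda>x y. poly p (F x y))"
proof -
  have "rank_le X Y (r ^ d) (\<lambda>x y. coeff p j * F x y ^ j)" if "j \<le> d" for j
    by (rule rank_le_mono[OF rank_le_cmult[OF rank_le_power[OF F, of j]] subset_refl subset_refl
          power_increasing[OF that r]])
  then have "rank_le X Y (card {..d} * r ^ d) (\<lambda>x y. \<Sum>j\<le>d. coeff p j * F x y ^ j)"
    by (intro rank_le_sum) auto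
  moreover have "poly p t = (\<Sum>j\<le>d. coeff p j * t ^ j)" for t
    unfolding poly_altdef using p
    by (intro sum.mono_neutral_left) (auto simp: coeff_eq_0)
  ultimately show ?thesis by simp
qed

lemma rank_le_cnj:
  assumes "rank_le X Y r F"
  shows "rank_le X Y r (\<lambda>x y. cnj (F x y))"
proof -
  obtain u v where "\<And>x y. x \<in> X \<Longrightarrow> y \<in> Y \<Longrightarrow> F x y = (\<Sum>i<r. u i x * v i y)"
    using rank_leE[OF assms] by blast
  then show ?thesis
    by (intro rank_leI[of "{..<r}" r X Y _ "\<lambda>i x. cnj (u i x)" "\<lambda>i y. cnj (v i y)"]) auto
qed

lemma rank_le_Re:
  assumes "rank_le X Y r F"
  shows "rank_le X Y (2 * r) (\<lambda>x y. Re (F x y))"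
proof -
  obtain u v where F: "\<And>x y. x \<in> X \<Longrightarrow> y \<in> Y \<Longrightarrow> F x y = (\<Sum>i<r. u i x * v i y)"
    using rank_leE[OF assms] by blast
  have "rank_le X Y r (\<lambda>x y. \<Sum>i<r. Re (u i x) * Re (v i y))"
    and "rank_le X Y r (\<lambda>x y. \<Sum>i<r. Im (u i x) * - Im (v i y))"
    by (rule rank_leI[of "{..<r}", OF _ _ refl]; simp)+
  then have "rank_le X Y (r + r)
      (\<lambda>x y. (\<Sum>i<r. Re (u i x) * Re (v i y)) + (\<Sum>i<r. Im (u i x) * - Im (v i y)))"
    by (rule rank_le_add)
  then show ?thesis
    by (simp add: rank_le_def F mult_2 sum_subtractf sum_negf)
qed

lemma rank_le_1_minor:
  assumes "rank_le X Y 1 F" "x \<in> X" "x' \<in> X" "y \<in> Y" "y' \<in> Y"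
  shows "F x y * F x' y' = F x y' * F x' y"
proof -
  obtain u v where "\<forall>x\<in>X. \<forall>y\<in>Y. F x y = u (0 :: nat) x * v (0 :: nat) y"
    using assms(1) by (auto simp: rank_le_def)
  then show ?thesis using assms(2-) by (simp add: mult_ac)
qed

lemma rank_le_1I:
  fixes F :: "'a \<Rightarrow> 'b \<Rightarrow> 'c::field"
  assumes "F x' y' \<noteq> 0" and "\<And>x y. x \<in> X \<Longrightarrow> y \<in> Y \<Longrightarrow> F x y * F x' y' = F x y' * F x' y"
  shows "rank_le X Y 1 F"
  using assms by (intro rank_leI[of "{()}" 1 X Y F "\<lambda>_ x. F x y'" "\<lambda>_ y. F x' y / F x' y'"])
    (auto simp: field_simps)

section \<open>Spectral decompositions and low-rank approximation\<close>

definition dot :: "'a set \<Rightarrow> ('a \<Rightarrow> real) \<Rightarrow> ('a \<Rightarrow> real) \<Rightarrow> real" where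
  "dot Y u v = (\<Sum>y\<in>Y. u y * v y)"

definition orthonormal :: "'a set \<Rightarrow> 'i set \<Rightarrow> ('i \<Rightarrow> 'a \<Rightarrow> real) \<Rightarrow> bool" where
  "orthonormal Y I q \<longleftrightarrow> (\<forall>i\<in>I. \<forall>j\<in>I. dot Y (q i) (q j) = (if i = j then 1 else 0))"

lemma dot_commute: "dot Y u v = dot Y v u"
  by (simp add: dot_def mult.commute)

lemma dot_self_nonneg: "0 \<le> dot Y u u"
  by (simp add: dot_def sum_nonneg)

lemma dot_self_eq_0_iff: "finite Y \<Longrightarrow> dot Y u u = 0 \<longleftrightarrow> (\<forall>y\<in>Y. u y = 0)"
  by (simp add: dot_def sum_nonneg_eq_0_iff)

lemma dot_sum_right: "dot Y u (\<lambda>y. \<Sum>j\<in>J. d j * q j y) = (\<Sum>j\<in>J. d j * dot Y u (q j))"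
proof -
  have "dot Y u (\<lambda>y. \<Sum>j\<in>J. d j * q j y) = (\<Sum>y\<in>Y. \<Sum>j\<in>J. d j * (u y * q j y))"
    by (simp add: dot_def sum_distrib_left mult_ac)
  also have "\<dots> = (\<Sum>j\<in>J. \<Sum>y\<in>Y. d j * (u y * q j y))" by (rule sum.swap)
  finally show ?thesis by (simp add: dot_def sum_distrib_left)
qed

lemma dot_orthonormal_sum:
  assumes "orthonormal Y J q" "finite J" "i \<in> J"
  shows "dot Y (q i) (\<lambda>y. \<Sum>j\<in>J. d j * q j y) = d i"
proof -
  have "dot Y (q i) (\<lambda>y. \<Sum>j\<in>J. d j * q j y) = (\<Sum>j\<in>J. if j = i then d j else 0)"
    unfolding dot_sum_right using assms by (intro sum.cong) (auto simp: orthonormal_def)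
  then show ?thesis using assms by simp
qed

lemma orthonormal_residual:
  assumes q: "orthonormal Y J q" "finite J"
  shows "dot Y (\<lambda>y. u y - (\<Sum>j\<in>J. d j * q j y)) (\<lambda>y. u y - (\<Sum>j\<in>J. d j * q j y))
    = dot Y u u - (\<Sum>j\<in>J. (dot Y u (q j))\<^sup>2) + (\<Sum>j\<in>J. (d j - dot Y u (q j))\<^sup>2)"
proof -
  let ?v = "\<lambda>y. \<Sum>j\<in>J. d j * q j y"
  have "dot Y ?v (q j) = d j" if "j \<in> J" for j
    using dot_orthonormal_sum[OF q that] by (simp add: dot_commute)
  then have "dot Y ?v ?v = (\<Sum>j\<in>J. (d j)\<^sup>2)"
    by (simp add: dot_sum_right power2_eq_square)
  moreover have "dot Y (\<lambda>y. u y - ?v y) (\<lambda>y. u y - ?v y) = dot Y u u - 2 * dot Y u ?v + dot Y ?v ?v"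
    by (simp add: dot_def algebra_simps sum.distrib sum_subtractf sum_distrib_left)
  ultimately show ?thesis
    by (simp add: dot_sum_right power2_diff sum.distrib sum_subtractf sum_distrib_left mult.assoc)
qed

lemma bessel_inequality:
  assumes "orthonormal Y J q" "finite J"
  shows "(\<Sum>j\<in>J. (dot Y u (q j))\<^sup>2) \<le> dot Y u u"
  using orthonormal_residual[OF assms, of u "\<lambda>j. dot Y u (q j)"]
    dot_self_nonneg[of Y "\<lambda>y. u y - (\<Sum>j\<in>J. dot Y u (q j) * q j y)"] by simp

lemma sum_square_dot:
  "(\<Sum>i\<in>I. l i * (dot Y (w i) p)\<^sup>2)
    = (\<Sum>y\<in>Y. \<Sum>z\<in>Y. (\<Sum>i\<in>I. l i * w i y * w i z) * (p y * p z))"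
proof -
  have "(\<Sum>i\<in>I. l i * (dot Y (w i) p)\<^sup>2)
      = (\<Sum>i\<in>I. \<Sum>y\<in>Y. \<Sum>z\<in>Y. l i * w i y * w i z * (p y * p z))"
    unfolding power2_eq_square dot_def sum_product unfolding sum_distrib_left
    by (simp add: mult_ac)
  also have "\<dots> = (\<Sum>y\<in>Y. \<Sum>i\<in>I. \<Sum>z\<in>Y. l i * w i y * w i z * (p y * p z))" by (rule sum.swap)
  also have "\<dots> = (\<Sum>y\<in>Y. \<Sum>z\<in>Y. \<Sum>i\<in>I. l i * w i y * w i z * (p y * p z))"
    by (intro sum.cong refl sum.swap)
  finally show ?thesis by (simp add: sum_distrib_right)
qed

definition spectral_decomposition ::
    "nat \<Rightarrow> (nat \<Rightarrow> nat \<Rightarrow> real) \<Rightarrow> (nat \<Rightarrow> real) \<Rightarrow> (nat \<Rightarrow> nat \<Rightarrow> real) \<Rightarrow> bool" where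
  "spectral_decomposition N A l w \<longleftrightarrow>
    orthonormal {..<N} {..<N} w \<and> orthonormal {..<N} {..<N} (\<lambda>y i. w i y) \<and>
    (\<forall>y<N. \<forall>z<N. A y z = (\<Sum>i<N. l i * w i y * w i z))"

lemma spectral_decomposition_mat:
  fixes A :: "real mat"
  assumes "A \<in> carrier_mat N N" "transpose_mat A = A" "char_poly A = (\<Prod>e\<leftarrow>es. [:- e, 1:])"
  shows "\<exists>w. spectral_decomposition N (\<lambda>y z. A $$ (y, z)) ((!) es) w"
proof -
  obtain U where U: "orthogonal_matrix N U" and A: "A = U * mat_diag N ((!) es) * transpose_mat U"
    using real_symmetric_spectral[OF assms] by blast
  note carrier = orthogonal_matrixD(1)[OF U]
  define w where "w i y = U $$ (y, i)" for i y
  have "dot {..<N} (w i) (w j) = (transpose_mat U * U) $$ (i, j)" if "i < N" "j < N" for i j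
    using that carrier by (simp add: w_def dot_def scalar_prod_def lessThan_atLeast0)
  then have "orthonormal {..<N} {..<N} w"
    using orthogonal_matrixD(2)[OF U] by (simp add: orthonormal_def)
  moreover have "dot {..<N} (\<lambda>i. w i y) (\<lambda>i. w i z) = (U * transpose_mat U) $$ (y, z)"
    if "y < N" "z < N" for y z
    using that carrier by (simp add: w_def dot_def scalar_prod_def lessThan_atLeast0)
  then have "orthonormal {..<N} {..<N} (\<lambda>y i. w i y)"
    using orthogonal_matrixD(3)[OF U] by (simp add: orthonormal_def)
  moreover have "A $$ (y, z) = (\<Sum>i<N. es ! i * w i y * w i z)" if "y < N" "z < N" for y z
    unfolding A mat_diag_mult_right[OF carrier] using that carrier
    by (simp add: w_def scalar_prod_def lessThan_atLeast0 mult_ac)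
  ultimately show ?thesis unfolding spectral_decomposition_def by blast
qed

lemma spectral_decomposition_exists:
  assumes sym: "\<And>y z. y < N \<Longrightarrow> z < N \<Longrightarrow> A y z = A z y"
  shows "\<exists>l w. spectral_decomposition N A l w"
proof -
  define M where "M = mat N N (\<lambda>(y, z). A y z)"
  have M: "M \<in> carrier_mat N N" "transpose_mat M = M"
    by (auto simp: M_def sym intro!: eq_matI)
  obtain es where "char_poly M = (\<Prod>e\<leftarrow>es. [:- e, 1:])"
    using real_symmetric_char_poly_splits[OF M] by blast
  then obtain w where "spectral_decomposition N (\<lambda>y z. M $$ (y, z)) ((!) es) w"
    using spectral_decomposition_mat[OF M] by blast
  then have "spectral_decomposition N A ((!) es) w"
    by (simp add: spectral_decomposition_def M_def)
  then show ?thesis by blast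
qed

lemma spectral_decomposition_eigenvector:
  assumes "spectral_decomposition N A l w" "i < N" "y < N"
  shows "(\<Sum>z<N. w i z * A y z) = l i * w i y"
proof -
  have "(\<Sum>z<N. w i z * A y z) = dot {..<N} (w i) (\<lambda>z. \<Sum>j<N. (l j * w j y) * w j z)"
    using assms by (simp add: spectral_decomposition_def dot_def)
  also have "\<dots> = l i * w i y"
    using assms by (intro dot_orthonormal_sum) (auto simp: spectral_decomposition_def)
  finally show ?thesis .
qed

lemma parseval:
  fixes w :: "nat \<Rightarrow> nat \<Rightarrow> real"
  assumes "orthonormal {..<N} {..<N} (\<lambda>y i. w i y)"
  shows "(\<Sum>i<N. (dot {..<N} (w i) p)\<^sup>2) = dot {..<N} p p"
proof -
  have "(\<Sum>i<N. (dot {..<N} (w i) p)\<^sup>2)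
      = (\<Sum>y<N. \<Sum>z<N. dot {..<N} (\<lambda>i. w i y) (\<lambda>i. w i z) * (p y * p z))"
    using sum_square_dot[of "\<lambda>_. 1"] by (simp add: dot_def)
  also have "\<dots> = (\<Sum>y<N. \<Sum>z<N. if z = y then p y * p z else 0)"
    using assms by (intro sum.cong refl) (auto simp: orthonormal_def)
  also have "\<dots> = dot {..<N} p p" by (simp add: dot_def)
  finally show ?thesis .
qed

definition gram :: "'a set \<Rightarrow> ('a \<Rightarrow> nat \<Rightarrow> real) \<Rightarrow> nat \<Rightarrow> nat \<Rightarrow> real" where
  "gram X M y z = (\<Sum>x\<in>X. M x y * M x z)"

lemma gram_quadratic_form:
  assumes "spectral_decomposition N (gram X M) l w"
  shows "(\<Sum>x\<in>X. (dot {..<N} (M x) p)\<^sup>2) = (\<Sum>i<N. l i * (dot {..<N} (w i) p)\<^sup>2)"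
proof -
  have "(\<Sum>x\<in>X. (dot {..<N} (M x) p)\<^sup>2) = (\<Sum>y<N. \<Sum>z<N. gram X M y z * (p y * p z))"
    using sum_square_dot[of "\<lambda>_. 1"] by (simp add: gram_def)
  also have "\<dots> = (\<Sum>y<N. \<Sum>z<N. (\<Sum>i<N. l i * w i y * w i z) * (p y * p z))"
    using assms by (intro sum.cong) (simp_all add: spectral_decomposition_def)
  also have "\<dots> = (\<Sum>i<N. l i * (dot {..<N} (w i) p)\<^sup>2)" by (rule sum_square_dot[symmetric])
  finally show ?thesis .
qed

lemma gram_eigenvalue_nonneg:
  assumes gram: "spectral_decomposition N (gram X M) l w" and k: "k < N"
  shows "0 \<le> l k"
proof -
  have "0 \<le> (\<Sum>x\<in>X. (dot {..<N} (M x) (w k))\<^sup>2)" by (simp add: sum_nonneg)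
  also have "\<dots> = (\<Sum>i<N. if i = k then l i else 0)"
    unfolding gram_quadratic_form[OF gram] using gram k
    by (intro sum.cong) (auto simp: spectral_decomposition_def orthonormal_def)
  finally show ?thesis using k by simp
qed

lemma gram_trace:
  assumes gram: "spectral_decomposition N (gram X M) l w"
  shows "(\<Sum>x\<in>X. dot {..<N} (M x) (M x)) = (\<Sum>i<N. l i)"
proof -
  have "(\<Sum>x\<in>X. dot {..<N} (M x) (M x)) = (\<Sum>y<N. gram X M y y)"
    unfolding dot_def gram_def by (rule sum.swap)
  also have "\<dots> = (\<Sum>y<N. \<Sum>i<N. l i * (w i y * w i y))"
    using gram by (simp add: spectral_decomposition_def mult.assoc)
  also have "\<dots> = (\<Sum>i<N. \<Sum>y<N. l i * (w i y * w i y))" by (rule sum.swap)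
  also have "\<dots> = (\<Sum>i<N. l i * dot {..<N} (w i) (w i))" by (simp add: dot_def sum_distrib_left)
  also have "\<dots> = (\<Sum>i<N. l i)"
    using gram by (simp add: spectral_decomposition_def orthonormal_def)
  finally show ?thesis .
qed

text \<open>An orthogonal matrix that diagonalizes the matrix of inner products of a family of vectors
  turns the family into an orthogonal one; no Gram-Schmidt process is needed.\<close>
lemma orthogonal_family_exists:
  fixes v :: "nat \<Rightarrow> 'a \<Rightarrow> real"
  obtains p w l where "\<forall>k<r. \<forall>m<r. dot Y (p k) (p m) = (if k = m then l k else 0)"
    and "\<forall>i<r. \<forall>y. v i y = (\<Sum>k<r. w k i * p k y)"
proof -
  define A where "A i j = dot Y (v i) (v j)" for i j
  obtain l w where A: "spectral_decomposition r A l w"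
    using spectral_decomposition_exists[of r A] dot_commute[of Y] by (auto simp: A_def)
  define p where "p k y = (\<Sum>i<r. w k i * v i y)" for k y
  show thesis
  proof (intro that allI impI)
    fix k m assume km: "k < r" "m < r"
    have "dot Y (v j) (p m) = l m * w m j" if "j < r" for j
      unfolding p_def dot_sum_right
      using spectral_decomposition_eigenvector[OF A km(2) that] by (simp add: A_def)
    then have "dot Y (p m) (p k) = (\<Sum>j<r. w k j * (l m * w m j))"
      unfolding p_def[of k] dot_sum_right by (simp add: dot_commute)
    also have "\<dots> = l m * dot {..<r} (w k) (w m)"
      by (simp add: dot_def sum_distrib_left mult_ac)
    also have "\<dots> = (if k = m then l k else 0)"
      using A km by (simp add: spectral_decomposition_def orthonormal_def)
    finally show "dot Y (p k) (p m) = (if k = m then l k else 0)"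
      by (simp add: dot_commute)
  next
    fix i y assume i: "i < r"
    have "(\<Sum>k<r. w k i * p k y) = (\<Sum>k<r. \<Sum>j<r. w k i * w k j * v j y)"
      by (simp add: p_def sum_distrib_left mult.assoc)
    also have "\<dots> = (\<Sum>j<r. dot {..<r} (\<lambda>k. w k i) (\<lambda>k. w k j) * v j y)"
      unfolding dot_def sum_distrib_right by (rule sum.swap)
    also have "\<dots> = (\<Sum>j<r. if j = i then v j y else 0)"
      using A i by (intro sum.cong) (auto simp: spectral_decomposition_def orthonormal_def)
    finally show "v i y = (\<Sum>k<r. w k i * p k y)" using i by simp
  qed
qed

lemma rank_le_orthonormal_factor:
  assumes "rank_le X Y r F" "finite Y"
  obtains J :: "nat set" and q d where "finite J" "card J \<le> r" "orthonormal Y J q"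
    and "\<forall>x\<in>X. \<forall>y\<in>Y. F x y = (\<Sum>j\<in>J. d x j * q j y)"
proof -
  obtain u v where F: "\<And>x y. x \<in> X \<Longrightarrow> y \<in> Y \<Longrightarrow> F x y = (\<Sum>i<r. u i x * v i y)"
    using rank_leE[OF assms(1)] by blast
  obtain p w l where p: "\<forall>k<r. \<forall>m<r. dot Y (p k) (p m) = (if k = m then l k else 0)"
    and v: "\<forall>i<r. \<forall>y. v i y = (\<Sum>k<r. w k i * p k y)"
    by (rule orthogonal_family_exists)
  define J where "J = {k. k < r \<and> l k \<noteq> 0}"
  have l: "l k > 0" if "k \<in> J" for k
    using that p dot_self_nonneg[of Y "p k"] by (simp add: J_def)
  have p_0: "p k y = 0" if "k < r" "k \<notin> J" "y \<in> Y" for k y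
    using that p dot_self_eq_0_iff[OF \<open>finite Y\<close>, of "p k"] by (simp add: J_def)
  define q where "q k y = p k y / sqrt (l k)" for k y
  define d where "d x k = (\<Sum>i<r. u i x * w k i) * sqrt (l k)" for x k
  show thesis
  proof (intro that ballI)
    show "finite J" "card J \<le> r"
      using card_mono[of "{..<r}" J] by (auto simp: J_def)
    have "dot Y (q k) (q m) = dot Y (p k) (p m) / (sqrt (l k) * sqrt (l m))" for k m
      by (simp add: q_def dot_def sum_divide_distrib)
    then show "orthonormal Y J q"
      using l p by (auto simp: orthonormal_def J_def abs_of_pos)
    fix x y assume xy: "x \<in> X" "y \<in> Y"
    have "F x y = (\<Sum>i<r. \<Sum>k<r. u i x * w k i * p k y)"
      by (simp add: F[OF xy] v sum_distrib_left mult.assoc)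
    also have "\<dots> = (\<Sum>k<r. (\<Sum>i<r. u i x * w k i) * p k y)"
      unfolding sum_distrib_right by (rule sum.swap)
    also have "\<dots> = (\<Sum>k\<in>J. (\<Sum>i<r. u i x * w k i) * p k y)"
      using p_0 xy by (intro sum.mono_neutral_right) (auto simp: J_def)
    also have "\<dots> = (\<Sum>k\<in>J. d x k * q k y)"
      by (intro sum.cong) (auto simp: d_def q_def J_def)
    finally show "F x y = (\<Sum>k\<in>J. d x k * q k y)" .
  qed
qed

lemma tail_sum_le_weighted_sum:
  fixes l c :: "nat \<Rightarrow> real"
  assumes l: "antimono_on {..<N} l" "\<And>i. i < N \<Longrightarrow> 0 \<le> l i"
    and c: "\<And>i. i < N \<Longrightarrow> 0 \<le> c i" "\<And>i. i < N \<Longrightarrow> c i \<le> 1" "(\<Sum>i<N. c i) \<le> real r"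
  shows "(\<Sum>i=r..<N. l i) \<le> (\<Sum>i<N. l i * (1 - c i))"
proof (cases "r < N")
  case True
  have split: "(\<Sum>i<N. g i) = (\<Sum>i<r. g i) + (\<Sum>i=r..<N. g i)" for g :: "nat \<Rightarrow> real"
    using True sum.atLeastLessThan_concat[of 0 r N g] by (simp add: lessThan_atLeast0)
  have "(\<Sum>i=r..<N. l i * c i) \<le> (\<Sum>i=r..<N. l r * c i)"
    using l c by (intro sum_mono mult_right_mono) (auto simp: monotone_on_def)
  also have "\<dots> = l r * (\<Sum>i=r..<N. c i)" by (simp add: sum_distrib_left)
  also have "\<dots> \<le> l r * (\<Sum>i<r. 1 - c i)"
    using c(3) l(2)[OF True] unfolding split by (intro mult_left_mono) (auto simp: sum_subtractf)
  also have "\<dots> = (\<Sum>i<r. l r * (1 - c i))" by (simp add: sum_distrib_left)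
  also have "\<dots> \<le> (\<Sum>i<r. l i * (1 - c i))"
    using l c True by (intro sum_mono mult_right_mono) (auto simp: monotone_on_def)
  finally show ?thesis unfolding split by (simp add: right_diff_distrib sum_subtractf)
qed (use l c in \<open>auto intro!: sum_nonneg mult_nonneg_nonneg\<close>)

theorem eckart_young:
  assumes gram: "spectral_decomposition N (gram X M) l w" and l: "antimono_on {..<N} l"
    and F: "rank_le X {..<N} r F"
  shows "(\<Sum>i=r..<N. l i) \<le> (\<Sum>x\<in>X. \<Sum>y<N. (M x y - F x y)\<^sup>2)"
proof -
  obtain J :: "nat set" and q d where J: "finite J" "card J \<le> r" and q: "orthonormal {..<N} J q"
    and F: "\<forall>x\<in>X. \<forall>y\<in>{..<N}. F x y = (\<Sum>j\<in>J. d x j * q j y)"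
    by (rule rank_le_orthonormal_factor[OF F finite_lessThan])
  have w: "orthonormal {..<N} {..<N} w" "orthonormal {..<N} {..<N} (\<lambda>y i. w i y)"
    using gram by (auto simp: spectral_decomposition_def)
  define c where "c i = (\<Sum>j\<in>J. (dot {..<N} (w i) (q j))\<^sup>2)" for i
  have "(\<Sum>i<N. c i) = (\<Sum>j\<in>J. \<Sum>i<N. (dot {..<N} (w i) (q j))\<^sup>2)"
    unfolding c_def by (rule sum.swap)
  also have "\<dots> = real (card J)"
    using q by (simp add: parseval[OF w(2)] orthonormal_def)
  finally have sum_c: "(\<Sum>i<N. c i) \<le> real r" using J by simp
  have c_le_1: "c i \<le> 1" if "i < N" for i
    using bessel_inequality[OF q J(1), of "w i"] w(1) that by (simp add: c_def orthonormal_def)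
  have energy: "(\<Sum>x\<in>X. \<Sum>j\<in>J. (dot {..<N} (M x) (q j))\<^sup>2) = (\<Sum>i<N. l i * c i)"
  proof -
    have "(\<Sum>x\<in>X. \<Sum>j\<in>J. (dot {..<N} (M x) (q j))\<^sup>2) = (\<Sum>j\<in>J. \<Sum>x\<in>X. (dot {..<N} (M x) (q j))\<^sup>2)"
      by (rule sum.swap)
    also have "\<dots> = (\<Sum>j\<in>J. \<Sum>i<N. l i * (dot {..<N} (w i) (q j))\<^sup>2)"
      by (simp only: gram_quadratic_form[OF gram])
    also have "\<dots> = (\<Sum>i<N. l i * c i)"
      unfolding c_def sum_distrib_left by (rule sum.swap)
    finally show ?thesis .
  qed
  have "(\<Sum>i=r..<N. l i) \<le> (\<Sum>i<N. l i * (1 - c i))"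
    using l gram_eigenvalue_nonneg[OF gram] c_le_1 sum_c
    by (intro tail_sum_le_weighted_sum) (auto simp: c_def sum_nonneg)
  also have "\<dots> = (\<Sum>x\<in>X. dot {..<N} (M x) (M x) - (\<Sum>j\<in>J. (dot {..<N} (M x) (q j))\<^sup>2))"
    by (simp add: right_diff_distrib sum_subtractf energy gram_trace[OF gram])
  also have "\<dots> \<le> (\<Sum>x\<in>X. dot {..<N} (\<lambda>y. M x y - (\<Sum>j\<in>J. d x j * q j y))
      (\<lambda>y. M x y - (\<Sum>j\<in>J. d x j * q j y)))"
    unfolding orthonormal_residual[OF q J(1)] by (intro sum_mono) (simp add: sum_nonneg)
  also have "\<dots> = (\<Sum>x\<in>X. \<Sum>y<N. (M x y - F x y)\<^sup>2)"
    unfolding dot_def by (intro sum.cong refl) (simp add: F power2_eq_square)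
  finally show ?thesis .
qed

section \<open>Root sums and entropies of sequences with small tails\<close>

lemma sum_lessThan_split:
  fixes g :: "nat \<Rightarrow> real"
  shows "(\<Sum>i<N. g i) = (\<Sum>i<min r N. g i) + (\<Sum>i=r..<N. g i)"
  using sum.atLeastLessThan_concat[of 0 r N g]
  by (cases "r \<le> N") (auto simp: lessThan_atLeast0 min_def)

lemma sum_sqrt_le:
  assumes "\<And>i. i \<in> I \<Longrightarrow> 0 \<le> l i"
  shows "(\<Sum>i\<in>I. sqrt (l i)) \<le> sqrt (card I) * sqrt (\<Sum>i\<in>I. l i)"
  using L2_set_mult_ineq[of "\<lambda>_. 1" "\<lambda>i. sqrt (l i)" I] assms
  by (simp add: L2_set_def)

lemma sum_sqrt_le_head_tail:
  fixes l :: "nat \<Rightarrow> real"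
  assumes l: "\<And>i. i < N \<Longrightarrow> 0 \<le> l i" "(\<Sum>i<N. l i) \<le> 1"
    and tail: "(\<Sum>i=r..<N. l i) \<le> e\<^sup>2" "0 \<le> e" and k: "k \<le> N"
  shows "(\<Sum>i<k. sqrt (l i)) \<le> sqrt r + sqrt k * e"
proof -
  have "(\<Sum>i<min r k. l i) \<le> (\<Sum>i<N. l i)"
    using l k by (intro sum_mono2) auto
  then have "sqrt (min r k) * sqrt (\<Sum>i<min r k. l i) \<le> sqrt r * 1"
    using l k by (intro mult_mono) (auto intro!: sum_nonneg)
  moreover have "(\<Sum>i<min r k. sqrt (l i)) \<le> sqrt (min r k) * sqrt (\<Sum>i<min r k. l i)"
    using sum_sqrt_le[of "{..<min r k}" l] l k by simp
  ultimately have head: "(\<Sum>i<min r k. sqrt (l i)) \<le> sqrt r" by simp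
  have "(\<Sum>i=r..<k. l i) \<le> (\<Sum>i=r..<N. l i)"
    using l k by (intro sum_mono2) auto
  then have "sqrt (\<Sum>i=r..<k. l i) \<le> e"
    using tail by (intro real_le_lsqrt) auto
  then have "sqrt (real (k - r)) * sqrt (\<Sum>i=r..<k. l i) \<le> sqrt k * e"
    using l k by (intro mult_mono) (auto intro: sum_nonneg)
  moreover have "(\<Sum>i=r..<k. sqrt (l i)) \<le> sqrt (real (k - r)) * sqrt (\<Sum>i=r..<k. l i)"
    using sum_sqrt_le[of "{r..<k}" l] l k by simp
  ultimately show ?thesis
    using head unfolding sum_lessThan_split[of _ k r] by linarith
qed

definition entropy_term :: "real \<Rightarrow> real" where
  "entropy_term x = - (x * log 2 x)"

lemma entropy_term_0 [simp]: "entropy_term 0 = 0"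
  by (simp add: entropy_term_def)

lemma entropy_term_le_iff: "entropy_term x \<le> y / ln 2 \<longleftrightarrow> - (x * ln x) \<le> y"
  by (simp add: entropy_term_def log_def field_simps)

lemma divide_ln_2_le: "0 \<le> x \<Longrightarrow> x / ln 2 \<le> 2 * (x :: real)"
  using ln_le_minus_one[of "1/2 :: real"] mult_left_mono[of 1 "2 * ln 2" x]
  by (simp add: ln_div field_simps)

lemma entropy_term_le_one_minus:
  assumes "0 \<le> x" "x \<le> 1"
  shows "entropy_term x \<le> 2 * (1 - x)"
proof (cases "x = 0")
  case False
  have "entropy_term x \<le> (1 - x) / ln 2"
    using ln_le_minus_one[of "1 / x"] assms False
    by (simp add: entropy_term_le_iff ln_div field_simps)
  also have "\<dots> \<le> 2 * (1 - x)" using assms by (intro divide_ln_2_le) simp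
  finally show ?thesis .
qed (use assms in simp)

lemma entropy_term_le_sqrt:
  assumes "0 \<le> x"
  shows "entropy_term x \<le> 4 * sqrt x"
proof (cases "x = 0")
  case False
  define t where "t = sqrt x"
  have t: "0 < t" "x = t\<^sup>2" using assms False by (auto simp: t_def)
  have "- (t * ln t) \<le> 1"
    using ln_le_minus_one[of "1 / t"] t by (simp add: ln_div field_simps)
  then have "- (x * ln x) \<le> 2 * t"
    using mult_left_mono[of "- (t * ln t)" 1 "2 * t"] t(1)
    unfolding t(2) ln_realpow by (simp add: power2_eq_square mult_ac)
  then have "entropy_term x \<le> (2 * t) / ln 2" by (simp only: entropy_term_le_iff)
  also have "\<dots> \<le> 2 * (2 * t)" using t by (intro divide_ln_2_le) simp
  finally show ?thesis by (simp add: t_def)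
qed simp

lemma sum_entropy_term_le:
  fixes l :: "'a \<Rightarrow> real" and K :: real
  assumes S: "finite S" "card S \<le> K" "0 < K" and l: "\<And>i. i \<in> S \<Longrightarrow> 0 \<le> l i"
  shows "(\<Sum>i\<in>S. entropy_term (l i)) \<le> entropy_term (\<Sum>i\<in>S. l i) + (\<Sum>i\<in>S. l i) * log 2 K"
proof (cases "(\<Sum>i\<in>S. l i) = 0")
  case True
  then show ?thesis using S l by (simp add: sum_nonneg_eq_0_iff)
next
  case False
  define s where "s = (\<Sum>i\<in>S. l i)"
  have s: "0 < s" using False l by (simp add: s_def order_less_le sum_nonneg)
  have gibbs: "entropy_term (l i) \<le> (l i * (ln K - ln s) + (s / K - l i)) / ln 2"
    if "i \<in> S" for i
  proof (cases "l i = 0")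
    case False
    then have pos: "0 < l i" using l[OF that] by simp
    have "l i * ln (s / (K * l i)) \<le> l i * (s / (K * l i) - 1)"
      using pos s S by (intro mult_left_mono ln_le_minus_one) auto
    also have "\<dots> = s / K - l i" using pos S by (simp add: field_simps)
    also have "ln (s / (K * l i)) = ln s - ln K - ln (l i)"
      using pos s S by (simp add: ln_div ln_mult)
    finally show ?thesis by (simp add: entropy_term_le_iff algebra_simps)
  qed (use s S in simp)
  have "(\<Sum>i\<in>S. entropy_term (l i)) \<le> (\<Sum>i\<in>S. (l i * (ln K - ln s) + (s / K - l i)) / ln 2)"
    by (intro sum_mono gibbs)
  also have "\<dots> = (s * (ln K - ln s) + (card S * (s / K) - s)) / ln 2"
    by (simp add: sum.distrib sum_subtractf s_def flip: sum_distrib_right sum_divide_distrib)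
  also have "card S * (s / K) - s \<le> 0"
    using S s by (simp add: field_simps mult_right_mono)
  finally show ?thesis by (simp add: s_def entropy_term_def log_def field_simps)
qed

lemma sum_entropy_term_le_head_tail:
  fixes l :: "nat \<Rightarrow> real"
  assumes l: "\<And>i. i < N \<Longrightarrow> 0 \<le> l i" "(\<Sum>i<N. l i) = 1"
    and tail: "(\<Sum>i=r..<N. l i) \<le> e\<^sup>2" "0 \<le> e" and r: "1 \<le> r"
  shows "(\<Sum>i<N. entropy_term (l i)) \<le> log 2 r + (log 2 N + 2) * e\<^sup>2 + 4 * e"
proof -
  define h where "h = (\<Sum>i<min r N. l i)"
  define t where "t = (\<Sum>i=r..<N. l i)"
  have ht: "h + t = 1" using l(2) by (simp add: h_def t_def sum_lessThan_split[of _ N r])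
  have h: "0 \<le> h" and t: "0 \<le> t" using l by (auto simp: h_def t_def intro!: sum_nonneg)
  have N: "0 < N" using l(2) by (cases N) auto
  have "(\<Sum>i<min r N. entropy_term (l i)) \<le> entropy_term h + h * log 2 r"
    unfolding h_def using l r by (intro sum_entropy_term_le) auto
  moreover have "entropy_term h \<le> 2 * e\<^sup>2"
    using entropy_term_le_one_minus[of h] h t ht tail by (simp add: t_def)
  moreover have "h * log 2 r \<le> log 2 r"
    using h t ht r by (intro mult_left_le_one_le) auto
  moreover have "(\<Sum>i=r..<N. entropy_term (l i)) \<le> entropy_term t + t * log 2 N"
    unfolding t_def using l N by (intro sum_entropy_term_le) auto
  moreover have "entropy_term t \<le> 4 * e"
  proof -
    have "sqrt t \<le> e" using tail by (intro real_le_lsqrt) (auto simp: t_def)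
    then show ?thesis using entropy_term_le_sqrt[OF t] by simp
  qed
  moreover have "t * log 2 N \<le> e\<^sup>2 * log 2 N"
    using tail N by (intro mult_right_mono) (auto simp: t_def)
  ultimately show ?thesis
    unfolding sum_lessThan_split[of _ N r] by (simp add: algebra_simps)
qed

section \<open>Singular values of the communication matrix\<close>

lemma proots_prod_linear_factors: "proots (\<Prod>e\<leftarrow>es. [:- e, 1:]) = mset (es :: 'a::idom list)"
proof (induction es)
  case (Cons e es)
  have "(\<Prod>e\<leftarrow>es. [:- e, 1:]) \<noteq> (0 :: 'a poly)" by (auto simp: prod_list_zero_iff)
  then show ?case using Cons proots_mult[of "[:- e, 1:]" "\<Prod>e\<leftarrow>es. [:- e, 1:]"] by simp
qed simp

lemma gram_Mf_carrier: "transpose_mat (Mf n f) * Mf n f \<in> carrier_mat (2 ^ n) (2 ^ n)"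
  by (auto simp: Mf_def)

lemma gram_Mf_symmetric:
  "transpose_mat (transpose_mat (Mf n f) * Mf n f) = transpose_mat (Mf n f) * Mf n f"
  by (simp add: Mf_def transpose_mult[of _ "2 ^ n" "2 ^ n" _ "2 ^ n"])

lemma mset_sv2_list: "mset (sv2_list n f) = sv2 n f"
  by (simp add: sv2_list_def)

lemma char_poly_sv2_list:
  "char_poly (transpose_mat (Mf n f) * Mf n f) = (\<Prod>e\<leftarrow>sv2_list n f. [:- e, 1:])"
proof -
  obtain es where es: "char_poly (transpose_mat (Mf n f) * Mf n f) = (\<Prod>e\<leftarrow>es. [:- e, 1:])"
    using real_symmetric_char_poly_splits[OF gram_Mf_carrier gram_Mf_symmetric] by blast
  then have "mset es = mset (sv2_list n f)"
    by (simp add: mset_sv2_list sv2_def proots_prod_linear_factors)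
  then have "mset (map (\<lambda>e. [:- e, 1:]) es) = mset (map (\<lambda>e. [:- e, 1:]) (sv2_list n f))"
    by simp
  then show ?thesis unfolding es by (metis prod_mset_prod_list)
qed

lemma length_sv2_list: "length (sv2_list n f) = 2 ^ n"
  using degree_monic_char_poly[OF gram_Mf_carrier[of n f]]
    degree_linear_factors[of uminus "sv2_list n f"]
  by (simp add: char_poly_sv2_list)

lemma antimono_on_sv2_list: "antimono_on {..<2 ^ n} ((!) (sv2_list n f))"
proof -
  have "sorted_wrt (\<ge>) (sv2_list n f)"
    unfolding sv2_list_def sorted_wrt_rev by simp
  then show ?thesis
    by (auto simp: monotone_on_def sorted_wrt_iff_nth_less length_sv2_list le_less)
qed

lemma sv2_list_spectral_decomposition:
  "\<exists>w. spectral_decomposition (2 ^ n) (gram {..<2 ^ n} (\<lambda>x y. f x y / 2 ^ n))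
    ((!) (sv2_list n f)) w"
proof -
  have "(transpose_mat (Mf n f) * Mf n f) $$ (y, z) = gram {..<2 ^ n} (\<lambda>x y. f x y / 2 ^ n) y z"
    if "y < 2 ^ n" "z < 2 ^ n" for y z
    using that by (simp add: Mf_def gram_def scalar_prod_def lessThan_atLeast0)
  then show ?thesis
    using spectral_decomposition_mat[OF gram_Mf_carrier gram_Mf_symmetric char_poly_sv2_list,
        of n f]
    by (simp add: spectral_decomposition_def)
qed

lemma sv2_list_nonneg: "i < 2 ^ n \<Longrightarrow> 0 \<le> sv2_list n f ! i"
  using sv2_list_spectral_decomposition[of n f] gram_eigenvalue_nonneg by blast

lemma sum_sv2_list:
  assumes "boolean_fun n f"
  shows "(\<Sum>i<2 ^ n. sv2_list n f ! i) = 1"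
proof -
  have sq: "f x y * f x y = 1" if "x < 2 ^ n" "y < 2 ^ n" for x y
    using assms that by (fastforce simp: boolean_fun_def)
  obtain w where
    "spectral_decomposition (2 ^ n) (gram {..<2 ^ n} (\<lambda>x y. f x y / 2 ^ n)) ((!) (sv2_list n f)) w"
    using sv2_list_spectral_decomposition by blast
  then have "(\<Sum>i<2 ^ n. sv2_list n f ! i)
      = (\<Sum>x<2 ^ n. dot {..<2 ^ n} (\<lambda>y. f x y / 2 ^ n) (\<lambda>y. f x y / 2 ^ n))"
    by (simp add: gram_trace)
  also have "\<dots> = (\<Sum>x<(2::nat) ^ n. \<Sum>y<(2::nat) ^ n. 1 / (2 ^ n * 2 ^ n))"
    unfolding dot_def by (intro sum.cong refl) (simp add: sq)
  finally show ?thesis by simp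
qed

definition approx_rank_le :: "nat \<Rightarrow> real \<Rightarrow> nat \<Rightarrow> (nat \<Rightarrow> nat \<Rightarrow> real) \<Rightarrow> bool" where
  "approx_rank_le n e r f \<longleftrightarrow> (\<exists>F. rank_le {..<2 ^ n} {..<2 ^ n} r F \<and>
    (\<forall>x<2 ^ n. \<forall>y<2 ^ n. \<bar>f x y - F x y\<bar> \<le> e))"

lemma approx_rank_le_nonneg:
  assumes "approx_rank_le n e r f"
  shows "0 \<le> e"
proof -
  obtain F where "\<forall>x<2 ^ n. \<forall>y<2 ^ n. \<bar>f x y - F x y\<bar> \<le> e"
    using assms unfolding approx_rank_le_def by blast
  then have "\<bar>f 0 0 - F 0 0\<bar> \<le> e" by simp
  then show ?thesis by linarith
qed

lemma approx_rank_le_mono: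
  assumes "approx_rank_le n e r f" "e \<le> e'" "r \<le> r'"
  shows "approx_rank_le n e' r' f"
proof -
  obtain F where F: "rank_le {..<2 ^ n} {..<2 ^ n} r F"
    and close: "\<forall>x<2 ^ n. \<forall>y<2 ^ n. \<bar>f x y - F x y\<bar> \<le> e"
    using assms(1) unfolding approx_rank_le_def by blast
  have "rank_le {..<2 ^ n} {..<2 ^ n} r' F"
    by (rule rank_le_mono[OF F subset_refl subset_refl assms(3)])
  moreover have "\<forall>x<2 ^ n. \<forall>y<2 ^ n. \<bar>f x y - F x y\<bar> \<le> e'"
    using close assms(2) by fastforce
  ultimately show ?thesis unfolding approx_rank_le_def by blast
qed

lemma sv2_list_tail:
  assumes "approx_rank_le n e r f"
  shows "(\<Sum>i=r..<2 ^ n. sv2_list n f ! i) \<le> e\<^sup>2"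
proof -
  obtain F where F: "rank_le {..<2 ^ n} {..<2 ^ n} r F"
    and close: "\<forall>x<2 ^ n. \<forall>y<2 ^ n. \<bar>f x y - F x y\<bar> \<le> e"
    using assms unfolding approx_rank_le_def by blast
  let ?M = "\<lambda>x y. f x y / 2 ^ n"
  obtain w where "spectral_decomposition (2 ^ n) (gram {..<2 ^ n} ?M) ((!) (sv2_list n f)) w"
    using sv2_list_spectral_decomposition by blast
  then have "(\<Sum>i=r..<2 ^ n. sv2_list n f ! i)
      \<le> (\<Sum>x<2 ^ n. \<Sum>y<2 ^ n. (?M x y - 1 / 2 ^ n * F x y)\<^sup>2)"
    by (rule eckart_young[OF _ antimono_on_sv2_list rank_le_cmult[OF F]])
  also have "\<dots> \<le> (\<Sum>x<(2::nat) ^ n. \<Sum>y<(2::nat) ^ n. e\<^sup>2 / (2 ^ n * 2 ^ n))"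
  proof (intro sum_mono)
    fix x y :: nat assume "x \<in> {..<2 ^ n}" "y \<in> {..<2 ^ n}"
    then have "\<bar>f x y - F x y\<bar>\<^sup>2 \<le> e\<^sup>2" using close by (intro power_mono) auto
    moreover have "(?M x y - 1 / 2 ^ n * F x y)\<^sup>2 = \<bar>f x y - F x y\<bar>\<^sup>2 / (2 ^ n * 2 ^ n)"
      by (simp add: power2_eq_square field_simps)
    ultimately show "(?M x y - 1 / 2 ^ n * F x y)\<^sup>2 \<le> e\<^sup>2 / (2 ^ n * 2 ^ n)"
      by (simp add: divide_right_mono)
  qed
  also have "\<dots> = e\<^sup>2" by simp
  finally show ?thesis .
qed

lemma entropy_sv_eq_sum: "entropy_sv n f = (\<Sum>i<2 ^ n. entropy_term (sv2_list n f ! i))"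
proof -
  have "entropy_sv n f = - (\<Sum>l\<in>#mset (sv2_list n f). - entropy_term l)"
    unfolding entropy_sv_def mset_sv2_list
    by (intro arg_cong[of _ _ "\<lambda>m. - \<Sum>\<^sub># m"] image_mset_cong) (simp add: entropy_term_def)
  also have "\<dots> = - (\<Sum>l\<leftarrow>sv2_list n f. - entropy_term l)"
    by (simp flip: mset_map sum_mset_sum_list)
  finally show ?thesis
    by (simp add: sum_list_sum_nth length_sv2_list lessThan_atLeast0 sum_negf)
qed

lemma kappa_eq_sum: "kappa n f k = (\<Sum>i<k. sqrt (sv2_list n f ! i))"
  unfolding kappa_def sigma_def
  by (rule sum.reindex_bij_witness[of _ Suc "\<lambda>i. i - 1"]) auto

lemma entropy_sv_le_approx_rank:
  assumes f: "boolean_fun n f" and approx: "approx_rank_le n e r f" and r: "1 \<le> r"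
  shows "entropy_sv n f \<le> log 2 r + (n + 2) * e\<^sup>2 + 4 * e"
  using sum_entropy_term_le_head_tail[OF sv2_list_nonneg sum_sv2_list[OF f] sv2_list_tail[OF approx]
      approx_rank_le_nonneg[OF approx] r]
  by (simp add: entropy_sv_eq_sum)

lemma kappa_le_approx_rank:
  assumes f: "boolean_fun n f" and k: "k \<le> 2 ^ n" and approx: "approx_rank_le n e r f"
  shows "kappa n f k \<le> sqrt r + sqrt k * e"
  unfolding kappa_eq_sum
  by (rule sum_sqrt_le_head_tail[OF sv2_list_nonneg _ sv2_list_tail[OF approx]
        approx_rank_le_nonneg[OF approx] k])
    (simp_all add: sum_sv2_list[OF f])

lemma kappa_le_sqrt:
  assumes f: "boolean_fun n f" and k: "k \<le> 2 ^ n"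
  shows "kappa n f k \<le> sqrt k"
proof -
  have "\<bar>f x y - 0\<bar> \<le> 1" if "x < 2 ^ n" "y < 2 ^ n" for x y
    using f that by (fastforce simp: boolean_fun_def)
  then have "approx_rank_le n 1 0 f"
    unfolding approx_rank_le_def by (intro exI[of _ "\<lambda>_ _. 0"]) (simp add: rank_le_def)
  from kappa_le_approx_rank[OF f k this] show ?thesis by simp
qed

lemma kappa_pos:
  assumes f: "boolean_fun n f" and k: "1 \<le> k" "k \<le> 2 ^ n"
  shows "0 < kappa n f k"
proof -
  have "0 < sv2_list n f ! 0"
  proof (rule ccontr)
    assume "\<not> 0 < sv2_list n f ! 0"
    then have "sv2_list n f ! i \<le> 0" if "i < 2 ^ n" for i
      using monotone_onD[OF antimono_on_sv2_list[of n f], of 0 i] that by simp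
    then have "(\<Sum>i<2 ^ n. sv2_list n f ! i) \<le> 0" by (intro sum_nonpos) simp
    then show False using sum_sv2_list[OF f] by simp
  qed
  then have "0 < sqrt (sv2_list n f ! 0)" by simp
  also have "\<dots> \<le> kappa n f k"
    unfolding kappa_eq_sum using k by (intro member_le_sum) (auto simp: sv2_list_nonneg)
  finally show ?thesis .
qed

section \<open>Schmidt rank of protocol states\<close>

definition basis_on :: "nat set \<Rightarrow> (nat \<Rightarrow> bool) set" where
  "basis_on S = {b. \<forall>i. i \<notin> S \<longrightarrow> \<not> b i}"

lemma basis_eq_basis_on: "basis m = basis_on {..<m}"
  by (auto simp: basis_def basis_on_def)

lemma finite_basis_on:
  assumes "finite S"
  shows "finite (basis_on S)"
proof -
  have "b \<in> (\<lambda>T i. i \<in> T) ` Pow S" if "b \<in> basis_on S" for b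
    using that by (intro image_eqI[of _ _ "{i. b i}"]) (auto simp: basis_on_def)
  then show ?thesis using assms by (meson finite_Pow_iff finite_imageI finite_subset subsetI)
qed

lemma finite_basis: "finite (basis m)"
  by (simp add: basis_eq_basis_on finite_basis_on)

text \<open>For disjoint \<open>S\<close> and \<open>T\<close>, the basis state \<open>sup a b\<close> is the tensor product of \<open>a\<close> and \<open>b\<close>.\<close>
lemma sum_basis_on_Un:
  assumes "S \<inter> T = {}"
  shows "(\<Sum>b\<in>basis_on (S \<union> T). g b) = (\<Sum>a\<in>basis_on S. \<Sum>b\<in>basis_on T. g (sup a b))"
proof -
  have "bij_betw (\<lambda>(a, b). sup a b) (basis_on S \<times> basis_on T) (basis_on (S \<union> T))"
    by (rule bij_betw_byWitness[where f' = "\<lambda>b. (restr b S, restr b T)"])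
      (use assms in \<open>force simp: basis_on_def restr_def fun_eq_iff\<close>)+
  then show ?thesis
    unfolding sum.cartesian_product
    by (subst sum.reindex_bij_betw[symmetric]) (auto intro!: sum.cong)
qed

lemma restr_sup:
  assumes "S \<inter> T = {}" "a \<in> basis_on S" "b \<in> basis_on T"
  shows "restr (sup a b) S = a" "restr (sup a b) T = b"
  using assms by (auto simp: basis_on_def restr_def fun_eq_iff)

lemma sup_basis_on_inject:
  assumes "S \<inter> T = {}" "a \<in> basis_on S" "b \<in> basis_on T" "a' \<in> basis_on S" "b' \<in> basis_on T"
  shows "sup a b = sup a' b' \<longleftrightarrow> a = a' \<and> b = b'"
  using restr_sup[OF assms(1)] assms(2-) by metis

lemma local_op_kernel:
  assumes K: "local_op m S K" and ST: "S \<inter> T = {}" "S \<union> T = {..<m}"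
  obtains L where "\<And>a a' b b'. a \<in> basis_on S \<Longrightarrow> a' \<in> basis_on S \<Longrightarrow> b \<in> basis_on T \<Longrightarrow>
    b' \<in> basis_on T \<Longrightarrow> K (sup a b) (sup a' b') = (if b' = b then L a a' else 0)"
proof -
  obtain L where L: "\<forall>b\<in>basis m. \<forall>b'\<in>basis m.
      K b b' = (if (\<forall>i. i \<notin> S \<longrightarrow> b i = b' i) then L (restr b S) (restr b' S) else 0)"
    using K unfolding local_op_def by (rule exE)
  show thesis
  proof
    fix a a' b b'
    assume aS: "a \<in> basis_on S" "a' \<in> basis_on S" and bT: "b \<in> basis_on T" "b' \<in> basis_on T"
    have "sup a b \<in> basis m" "sup a' b' \<in> basis m"
      using aS bT unfolding basis_eq_basis_on ST(2)[symmetric] by (auto simp: basis_on_def)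
    moreover have "(\<forall>i. i \<notin> S \<longrightarrow> sup a b i = sup a' b' i) \<longleftrightarrow> b' = b"
    proof -
      have "sup a b i = sup a' b' i \<longleftrightarrow> b' i = b i" if "i \<notin> S" for i
        using that aS by (auto simp: basis_on_def)
      moreover have "b' i = b i" if "i \<in> S" for i
        using that ST(1) bT by (auto simp: basis_on_def)
      ultimately show ?thesis unfolding fun_eq_iff by blast
    qed
    ultimately show "K (sup a b) (sup a' b') = (if b' = b then L a a' else 0)"
      using L aS bT by (simp only: restr_sup[OF ST(1)])
  qed
qed

lemma apply_local_op:
  assumes K: "local_op m S K" and ST: "S \<inter> T = {}" "S \<union> T = {..<m}"
  obtains L where "\<And>\<psi> a b. a \<in> basis_on S \<Longrightarrow> b \<in> basis_on T \<Longrightarrow>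
    apply_op m K \<psi> (sup a b) = (\<Sum>a'\<in>basis_on S. L a a' * \<psi> (sup a' b))"
proof -
  obtain L where kernel: "\<And>a a' b b'. a \<in> basis_on S \<Longrightarrow> a' \<in> basis_on S \<Longrightarrow> b \<in> basis_on T \<Longrightarrow>
      b' \<in> basis_on T \<Longrightarrow> K (sup a b) (sup a' b') = (if b' = b then L a a' else 0)"
    using local_op_kernel[OF K ST] by blast
  have finite: "finite (basis_on T)"
    using ST finite_subset[of T "{..<m}"] by (auto intro: finite_basis_on)
  show thesis
  proof
    fix \<psi> a b assume ab: "a \<in> basis_on S" "b \<in> basis_on T"
    have "apply_op m K \<psi> (sup a b)
        = (\<Sum>a'\<in>basis_on S. \<Sum>b'\<in>basis_on T. K (sup a b) (sup a' b') * \<psi> (sup a' b'))"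
      unfolding apply_op_def basis_eq_basis_on ST(2)[symmetric] by (rule sum_basis_on_Un[OF ST(1)])
    also have "\<dots> = (\<Sum>a'\<in>basis_on S. \<Sum>b'\<in>basis_on T.
        if b' = b then L a a' * \<psi> (sup a' b') else 0)"
      using ab by (intro sum.cong refl) (simp add: kernel)
    also have "\<dots> = (\<Sum>a'\<in>basis_on S. L a a' * \<psi> (sup a' b))"
      using ab finite by simp
    finally show "apply_op m K \<psi> (sup a b) = (\<Sum>a'\<in>basis_on S. L a a' * \<psi> (sup a' b))" .
  qed
qed

text \<open>The rows are indexed by the input and the qubits \<open>S\<close> of one player, the columns by those of
  the other, so that a bound of \<open>r\<close> is a decomposition of the states into \<open>r\<close> products in which each
  factor depends on the input of one player only (Yao, Kremer).\<close>
definition schmidt_rank_le ::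
    "nat set \<Rightarrow> nat set \<Rightarrow> nat \<Rightarrow> ('x \<Rightarrow> 'y \<Rightarrow> qstate) \<Rightarrow> bool" where
  "schmidt_rank_le S T r \<Psi> \<longleftrightarrow>
    rank_le (UNIV \<times> basis_on S) (UNIV \<times> basis_on T) r (\<lambda>(x, a) (y, b). \<Psi> x y (sup a b))"

lemma schmidt_rank_le_swap:
  assumes "schmidt_rank_le S T r \<Psi>"
  shows "schmidt_rank_le T S r (\<lambda>y x. \<Psi> x y)"
  using rank_le_transpose[OF assms[unfolded schmidt_rank_le_def]]
  by (simp add: schmidt_rank_le_def case_prod_unfold sup_commute)

lemma schmidt_rank_le_local_op:
  assumes \<Psi>: "schmidt_rank_le S T r \<Psi>" and K: "local_op m S K"
    and ST: "S \<inter> T = {}" "S \<union> T = {..<m}"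
  shows "schmidt_rank_le S T r (\<lambda>x y. apply_op m K (\<Psi> x y))"
proof -
  obtain L where L: "\<And>\<psi> a b. a \<in> basis_on S \<Longrightarrow> b \<in> basis_on T \<Longrightarrow>
      apply_op m K \<psi> (sup a b) = (\<Sum>a'\<in>basis_on S. L a a' * \<psi> (sup a' b))"
    using apply_local_op[OF K ST] by blast
  let ?\<Psi> = "\<lambda>(x, a) (y, b). \<Psi> x y (sup a b)"
  have "rank_le (UNIV \<times> basis_on S) (UNIV \<times> basis_on T) r
      (\<lambda>xa yb. \<Sum>a'\<in>basis_on S. L (snd xa) a' * ?\<Psi> (fst xa, a') yb)"
    by (rule rank_le_row_combination[OF \<Psi>[unfolded schmidt_rank_le_def]]) auto
  then show ?thesis
    unfolding schmidt_rank_le_def by (simp add: rank_le_def L case_prod_unfold)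
qed

lemma schmidt_rank_le_send:
  assumes \<Psi>: "schmidt_rank_le S T r \<Psi>" and q: "q \<in> S" "q \<notin> T"
  shows "schmidt_rank_le (S - {q}) (insert q T) (2 * r) \<Psi>"
proof -
  let ?\<Psi> = "\<lambda>(x, a) (y, b). \<Psi> x y (sup a b)"
  define branch where "branch v = (\<lambda>(x, a) (y, b). (if b q = v then 1 else 0)
      * ?\<Psi> (x, a(q := v)) (y, b(q := False)))" for v
  have "rank_le (UNIV \<times> basis_on (S - {q})) (UNIV \<times> basis_on (insert q T)) r (branch v)" for v
  proof -
    have "rank_le (UNIV \<times> basis_on (S - {q})) (UNIV \<times> basis_on T) r
        (\<lambda>xa yb. \<Sum>k\<in>{()}. 1 * ?\<Psi> (fst xa, (snd xa)(q := v)) yb)"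
      by (rule rank_le_row_combination[OF \<Psi>[unfolded schmidt_rank_le_def]])
        (use q in \<open>auto simp: basis_on_def\<close>)
    from rank_le_col_combination[OF this, of "UNIV \<times> basis_on (insert q T)" "{()}"
        "\<lambda>yb k. (fst yb, (snd yb)(q := False))" "\<lambda>yb k. if snd yb q = v then 1 else 0"]
    show ?thesis using q by (auto simp: basis_on_def branch_def case_prod_unfold)
  qed
  then have "rank_le (UNIV \<times> basis_on (S - {q})) (UNIV \<times> basis_on (insert q T)) (r + r)
      (\<lambda>xa yb. branch True xa yb + branch False xa yb)"
    by (intro rank_le_add)
  moreover have "branch True (x, a) (y, b) + branch False (x, a) (y, b) = \<Psi> x y (sup a b)"
    if "a \<in> basis_on (S - {q})" for x y a b
  proof -
    have "sup (a(q := b q)) (b(q := False)) = sup a b"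
      using that by (auto simp: fun_eq_iff basis_on_def)
    then show ?thesis by (cases "b q") (simp_all add: branch_def)
  qed
  ultimately show ?thesis
    unfolding schmidt_rank_le_def by (auto simp: rank_le_def mult_2)
qed

lemma rank_le_weighted_norm_square:
  assumes \<Psi>: "schmidt_rank_le S T r \<Psi>" and ST: "S \<inter> T = {}" "S \<union> T = {..<m}" and t: "t \<in> S"
  shows "rank_le UNIV UNIV (r * r)
    (\<lambda>x y. \<Sum>b\<in>basis m. h (b t) * complex_of_real ((cmod (\<Psi> x y b))\<^sup>2))"
proof -
  let ?\<Psi> = "\<lambda>(x, a) (y, b). \<Psi> x y (sup a b)"
  have "rank_le (UNIV \<times> basis_on S) (UNIV \<times> basis_on T) (r * r) (\<lambda>xa yb. ?\<Psi> xa yb * cnj (?\<Psi> xa yb))"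
    using \<Psi> unfolding schmidt_rank_le_def by (intro rank_le_mult rank_le_cnj)
  from rank_le_row_combination[OF this, of UNIV "basis_on S" Pair "\<lambda>_ a. h (a t)"]
  have "rank_le UNIV (UNIV \<times> basis_on T) (r * r)
      (\<lambda>x yb. \<Sum>a\<in>basis_on S. h (a t) * (?\<Psi> (x, a) yb * cnj (?\<Psi> (x, a) yb)))" by auto
  from rank_le_col_combination[OF this, of UNIV "basis_on T" Pair "\<lambda>_ _. 1"]
  have "rank_le UNIV UNIV (r * r) (\<lambda>x y. \<Sum>b\<in>basis_on T. \<Sum>a\<in>basis_on S.
      h (a t) * complex_of_real ((cmod (\<Psi> x y (sup a b)))\<^sup>2))"
    unfolding complex_norm_square by auto
  moreover have "(\<Sum>b\<in>basis m. h (b t) * g b)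
      = (\<Sum>b\<in>basis_on T. \<Sum>a\<in>basis_on S. h (a t) * g (sup a b))"
    for g :: "(nat \<Rightarrow> bool) \<Rightarrow> complex"
  proof -
    have "h (sup a b t) = h (a t)" if "b \<in> basis_on T" for a b
      using that t ST(1) by (auto simp: basis_on_def)
    then have "(\<Sum>b\<in>basis m. h (b t) * g b) = (\<Sum>a\<in>basis_on S. \<Sum>b\<in>basis_on T. h (a t) * g (sup a b))"
      unfolding basis_eq_basis_on ST(2)[symmetric] sum_basis_on_Un[OF ST(1)]
      by (intro sum.cong refl) simp
    then show ?thesis by (simp add: sum.swap[of _ "basis_on T"])
  qed
  ultimately show ?thesis by simp
qed

definition held :: "nat \<Rightarrow> (nat \<Rightarrow> bool) \<Rightarrow> bool \<Rightarrow> nat set" where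
  "held m own p = {i. i < m \<and> own i = p}"

lemma held_partition:
  "held m own p \<inter> held m own (\<not> p) = {}" "held m own p \<union> held m own (\<not> p) = {..<m}"
  by (auto simp: held_def)

lemma held_send:
  assumes "q < m" "own q = p"
  shows "held m (own(q := \<not> p)) p = held m own p - {q}"
    and "held m (own(q := \<not> p)) (\<not> p) = insert q (held m own (\<not> p))"
  using assms by (auto simp: held_def)

definition split_rank_le :: "nat \<Rightarrow> (nat \<Rightarrow> bool) \<Rightarrow> nat \<Rightarrow> (nat \<Rightarrow> nat \<Rightarrow> qstate) \<Rightarrow> bool" where
  "split_rank_le m own r \<Psi> \<longleftrightarrow> schmidt_rank_le (held m own True) (held m own False) r \<Psi>"

lemma split_rank_le_player:
  "split_rank_le m own r \<Psi> \<longleftrightarrow>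
    schmidt_rank_le (held m own p) (held m own (\<not> p)) r (if p then \<Psi> else (\<lambda>y x. \<Psi> x y))"
  using schmidt_rank_le_swap[of "held m own False" "held m own True" r "\<lambda>y x. \<Psi> x y"]
    schmidt_rank_le_swap[of "held m own True" "held m own False" r \<Psi>]
  by (cases p) (auto simp: split_rank_le_def)

lemma split_rank_le_local_op:
  assumes "split_rank_le m own r \<Psi>" "local_op m (held m own p) K"
  shows "split_rank_le m own r (\<lambda>x y. apply_op m K (\<Psi> x y))"
  using schmidt_rank_le_local_op[OF assms(1)[unfolded split_rank_le_player[of _ _ _ _ p]] assms(2)
      held_partition]
  by (cases p) (auto simp: split_rank_le_player[of _ _ _ _ p])

lemma split_rank_le_send:
  assumes "split_rank_le m own r \<Psi>" "q < m" "own q = p"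
  shows "split_rank_le m (own(q := \<not> p)) (2 * r) \<Psi>"
  using schmidt_rank_le_send[OF assms(1)[unfolded split_rank_le_player[of _ _ _ _ p]], of q]
    assms(2,3)
  by (simp only: split_rank_le_player[of _ _ _ _ p] held_send) (simp add: held_def)

lemma split_rank_le_evolve:
  assumes "split_rank_le m own r \<Psi>" "valid_rounds m own rs"
  shows "split_rank_le m (final_owner own rs) (2 ^ length rs * r) (\<lambda>x y. evolve m rs (\<Psi> x y))"
  using assms
proof (induction rs arbitrary: own r \<Psi>)
  case (Cons a rs)
  obtain p K q where a: "a = (p, K, q)" by (cases a)
  have "split_rank_le m (own(q := \<not> p)) (2 * r) (\<lambda>x y. apply_op m K (\<Psi> x y))"
    using Cons.prems by (intro split_rank_le_send split_rank_le_local_op[of _ _ _ _ p])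
      (auto simp: a held_def)
  from Cons.IH[OF this] show ?case using Cons.prems by (simp add: a mult_ac del: fun_upd_apply)
qed simp

lemma init_basis_eq_sup: "init_basis n x y = sup (init_basis n x 0) (init_basis n 0 y)"
  by (auto simp: init_basis_def fun_eq_iff)

lemma init_basis_in_basis: "2 * n \<le> m \<Longrightarrow> init_basis n x y \<in> basis m"
  by (auto simp: basis_def init_basis_def)

lemma split_rank_le_init_state:
  assumes "2 * n \<le> m" "\<forall>i<n. own i" "\<forall>i. n \<le> i \<and> i < 2 * n \<longrightarrow> \<not> own i"
  shows "split_rank_le m own 1 (init_state n)"
proof -
  let ?S = "held m own True" and ?T = "held m own False"
  have x: "init_basis n x 0 \<in> basis_on ?S" and y: "init_basis n 0 y \<in> basis_on ?T" for x y
    using assms by (auto simp: basis_on_def held_def init_basis_def)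
  have "init_state n x y (sup a b)
      = (if a = init_basis n x 0 then 1 else 0) * (if b = init_basis n 0 y then 1 else 0)"
    if "a \<in> basis_on ?S" "b \<in> basis_on ?T" for x y a b
    using sup_basis_on_inject[of ?S ?T a b, OF _ that x y] held_partition(1)[of m own True]
    by (simp add: init_state_def init_basis_eq_sup[of n x y])
  then have "rank_le (UNIV \<times> basis_on ?S) (UNIV \<times> basis_on ?T) 1
      (\<lambda>(x, a) (y, b). init_state n x y (sup a b))"
    by (intro rank_leI[of "{()}" 1 _ _ _
          "\<lambda>_ (x, a). if a = init_basis n x 0 then 1 else 0"
          "\<lambda>_ (y, b). if b = init_basis n 0 y then 1 else 0"]) auto
  then show ?thesis by (simp add: split_rank_le_def schmidt_rank_le_def)
qed

lemma split_rank_le_final_state: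
  assumes "valid_protocol n P"
  shows "split_rank_le (nqubits P) (final_owner (own0 P) (rounds P)) (2 ^ length (rounds P))
    (final_state n P)"
proof -
  note valid = assms[unfolded valid_protocol_def Let_def]
  have "split_rank_le (nqubits P) (final_owner (own0 P) (rounds P)) (2 ^ length (rounds P))
      (\<lambda>x y. evolve (nqubits P) (rounds P) (init_state n x y))"
    using split_rank_le_evolve[OF split_rank_le_init_state, of n "nqubits P" "own0 P" "rounds P"]
      valid by simp
  from split_rank_le_local_op[OF this, of "fin_player P" "fin_op P"] show ?thesis
    using valid by (simp add: held_def final_state_def[abs_def])
qed

section \<open>Outcome probabilities\<close>

definition norm_square :: "nat \<Rightarrow> qstate \<Rightarrow> real" where
  "norm_square m \<psi> = (\<Sum>b\<in>basis m. (cmod (\<psi> b))\<^sup>2)"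

lemma norm_square_apply_op:
  assumes "unitary_op m K"
  shows "norm_square m (apply_op m K \<psi>) = norm_square m \<psi>"
proof -
  have "complex_of_real (norm_square m (apply_op m K \<psi>))
      = (\<Sum>b\<in>basis m. \<Sum>b2\<in>basis m. \<Sum>b1\<in>basis m. (K b b2 * \<psi> b2) * cnj (K b b1 * \<psi> b1))"
    unfolding norm_square_def of_real_sum complex_norm_square apply_op_def cnj_sum sum_product ..
  also have "\<dots> = (\<Sum>b2\<in>basis m. \<Sum>b\<in>basis m. \<Sum>b1\<in>basis m. (K b b2 * \<psi> b2) * cnj (K b b1 * \<psi> b1))"
    by (rule sum.swap)
  also have "\<dots> = (\<Sum>b2\<in>basis m. \<Sum>b1\<in>basis m. \<Sum>b\<in>basis m. (K b b2 * \<psi> b2) * cnj (K b b1 * \<psi> b1))"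
    by (intro sum.cong refl sum.swap)
  also have "\<dots> = (\<Sum>b2\<in>basis m. \<Sum>b1\<in>basis m.
      (\<Sum>b\<in>basis m. cnj (K b b1) * K b b2) * (\<psi> b2 * cnj (\<psi> b1)))"
    unfolding sum_distrib_right by (simp add: mult_ac)
  also have "\<dots> = (\<Sum>b2\<in>basis m. \<Sum>b1\<in>basis m. if b1 = b2 then \<psi> b2 * cnj (\<psi> b1) else 0)"
    using assms by (intro sum.cong refl) (auto simp: unitary_op_def)
  also have "\<dots> = complex_of_real (norm_square m \<psi>)"
    unfolding norm_square_def of_real_sum complex_norm_square by (simp add: finite_basis)
  finally show ?thesis by (simp only: of_real_eq_iff)
qed

lemma norm_square_evolve: "valid_rounds m own rs \<Longrightarrow> norm_square m (evolve m rs \<psi>) = norm_square m \<psi>"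
  by (induction m own rs arbitrary: \<psi> rule: valid_rounds.induct) (auto simp: norm_square_apply_op)

lemma norm_square_final_state:
  assumes "valid_protocol n P"
  shows "norm_square (nqubits P) (final_state n P x y) = 1"
proof -
  note valid = assms[unfolded valid_protocol_def Let_def]
  have "norm_square (nqubits P) (final_state n P x y) = norm_square (nqubits P) (init_state n x y)"
    using valid by (auto simp: final_state_def norm_square_apply_op norm_square_evolve)
  also have "\<dots> = (\<Sum>b\<in>basis (nqubits P). if b = init_basis n x y then 1 else 0)"
    unfolding norm_square_def by (intro sum.cong) (auto simp: init_state_def)
  also have "\<dots> = 1"
    using valid by (simp add: finite_basis init_basis_in_basis)
  finally show ?thesis .
qed

lemma prob_out_eq_sum:
  "prob_out n P x y c = (\<Sum>b\<in>basis (nqubits P).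
    (if b (out_qubit P) = c then 1 else 0) * (cmod (final_state n P x y b))\<^sup>2)"
  unfolding prob_out_def sum.inter_filter[OF finite_basis] by (intro sum.cong) auto

lemma prob_out_False:
  assumes "valid_protocol n P"
  shows "prob_out n P x y False = 1 - prob_out n P x y True"
proof -
  have "prob_out n P x y True + prob_out n P x y False
      = norm_square (nqubits P) (final_state n P x y)"
    unfolding prob_out_eq_sum norm_square_def sum.distrib[symmetric] by (intro sum.cong) auto
  then show ?thesis using norm_square_final_state[OF assms] by simp
qed

lemma prob_out_nonneg: "0 \<le> prob_out n P x y c"
  by (simp add: prob_out_def sum_nonneg)

lemma rank_le_expected_output:
  assumes valid: "valid_protocol n P"
  shows "rank_le UNIV UNIV (4 ^ length (rounds P)) (\<lambda>x y. complex_of_real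
    (\<alpha> * prob_out n P x y True + \<beta> * prob_out n P x y False))"
proof -
  define own where "own = final_owner (own0 P) (rounds P)"
  define p where "p = own (out_qubit P)"
  define \<Phi> where "\<Phi> = (if p then final_state n P else (\<lambda>y x. final_state n P x y))"
  define h where "h v = (if v then complex_of_real \<alpha> else complex_of_real \<beta>)" for v
  have "schmidt_rank_le (held (nqubits P) own p) (held (nqubits P) own (\<not> p))
      (2 ^ length (rounds P)) \<Phi>"
    using split_rank_le_final_state[OF valid]
    by (simp add: split_rank_le_player[of _ _ _ _ p] own_def \<Phi>_def)
  moreover have "out_qubit P \<in> held (nqubits P) own p"
    using valid by (simp add: valid_protocol_def Let_def held_def p_def)
  ultimately have "rank_le UNIV UNIV (2 ^ length (rounds P) * 2 ^ length (rounds P))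
      (\<lambda>x y. \<Sum>b\<in>basis (nqubits P).
        h (b (out_qubit P)) * complex_of_real ((cmod (\<Phi> x y b))\<^sup>2))"
    by (rule rank_le_weighted_norm_square[OF _ held_partition])
  moreover have "2 ^ length (rounds P) * 2 ^ length (rounds P) = (4::nat) ^ length (rounds P)"
    by (simp flip: power_mult_distrib)
  ultimately have "rank_le UNIV UNIV (4 ^ length (rounds P)) (\<lambda>x y. \<Sum>b\<in>basis (nqubits P).
      h (b (out_qubit P)) * complex_of_real ((cmod (\<Phi> x y b))\<^sup>2))"
    by simp
  then have "rank_le UNIV UNIV (4 ^ length (rounds P)) (\<lambda>x y. \<Sum>b\<in>basis (nqubits P).
      h (b (out_qubit P)) * complex_of_real ((cmod (final_state n P x y b))\<^sup>2))"
    using rank_le_transpose by (cases p) (force simp: \<Phi>_def)+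
  moreover have "(\<Sum>b\<in>basis (nqubits P).
      h (b (out_qubit P)) * complex_of_real ((cmod (final_state n P x y b))\<^sup>2))
    = complex_of_real (\<alpha> * prob_out n P x y True + \<beta> * prob_out n P x y False)" for x y
    unfolding prob_out_eq_sum sum_distrib_left sum.distrib[symmetric] of_real_sum
    by (intro sum.cong) (auto simp: h_def)
  ultimately show ?thesis by simp
qed

section \<open>Amplification by majority voting\<close>

text \<open>The probability that more than half of \<open>2 m + 1\<close> independent coins show heads, as a polynomial
  in the probability of heads.\<close>
definition majority_poly :: "nat \<Rightarrow> real poly" where
  "majority_poly m = (\<Sum>j=m + 1..2 * m + 1.
    of_nat (2 * m + 1 choose j) * ([:0, 1:] ^ j * [:1, - 1:] ^ (2 * m + 1 - j)))"

lemma degree_majority_poly: "degree (majority_poly m) \<le> 2 * m + 1"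
  unfolding majority_poly_def
proof (rule degree_sum_le)
  fix j assume j: "j \<in> {m + 1..2 * m + 1}"
  have "degree ([:0, 1:] ^ j * [:1, - 1 :: real:] ^ (2 * m + 1 - j))
      \<le> degree [:0, 1 :: real:] * j + degree [:1, - 1 :: real:] * (2 * m + 1 - j)"
    by (intro order_trans[OF degree_mult_le] add_mono degree_power_le)
  also have "\<dots> = 2 * m + 1" using j by simp
  finally show "degree (of_nat (2 * m + 1 choose j)
      * ([:0, 1:] ^ j * [:1, - 1 :: real:] ^ (2 * m + 1 - j))) \<le> 2 * m + 1"
    by (intro order_trans[OF degree_mult_le]) simp
qed simp

lemma poly_majority_poly:
  "poly (majority_poly m) p
    = (\<Sum>j=m + 1..2 * m + 1. real (2 * m + 1 choose j) * (p ^ j * (1 - p) ^ (2 * m + 1 - j)))"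
  by (simp add: majority_poly_def poly_sum)

lemma poly_majority_poly_complement:
  "poly (majority_poly m) (1 - p) = 1 - poly (majority_poly m) p"
proof -
  let ?t = "\<lambda>j. real (2 * m + 1 choose j) * (p ^ j * (1 - p) ^ (2 * m + 1 - j))"
  have "poly (majority_poly m) (1 - p) = (\<Sum>j\<le>m. ?t j)"
    unfolding poly_majority_poly
    by (rule sum.reindex_bij_witness[of _ "\<lambda>j. 2 * m + 1 - j" "\<lambda>j. 2 * m + 1 - j"])
      (auto simp: binomial_symmetric[symmetric] mult.commute)
  moreover have "(\<Sum>j\<le>m. ?t j) + (\<Sum>j=m + 1..2 * m + 1. ?t j) = (\<Sum>j\<le>2 * m + 1. ?t j)"
  proof -
    have "{..2 * m + 1} = {..m} \<union> {m + 1..2 * m + 1}" by auto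
    then show ?thesis by (simp only:) (rule sum.union_disjoint[symmetric]; force)
  qed
  moreover have "(\<Sum>j\<le>2 * m + 1. ?t j) = 1"
    using binomial_ring[of p "1 - p" "2 * m + 1"] by (simp add: mult.assoc)
  ultimately show ?thesis unfolding poly_majority_poly by linarith
qed

lemma poly_majority_poly_bounds:
  assumes p: "0 \<le> p" "p \<le> 1/3"
  shows "0 \<le> poly (majority_poly m) p" "poly (majority_poly m) p \<le> (8/9) ^ m"
proof -
  define q where "q = 1 - p"
  have q: "0 \<le> q" "p \<le> q" using p by (auto simp: q_def)
  show "0 \<le> poly (majority_poly m) p"
    unfolding poly_majority_poly using p by (intro sum_nonneg mult_nonneg_nonneg) auto
  have term_bound: "p ^ j * q ^ (2 * m + 1 - j) \<le> p * (p * q) ^ m"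
    if j: "m + 1 \<le> j" "j \<le> 2 * m + 1" for j
  proof -
    have "p ^ j * q ^ (2 * m + 1 - j) = p ^ (m + 1) * (p ^ (j - (m + 1)) * q ^ (2 * m + 1 - j))"
      using j by (simp only: mult.assoc[symmetric] power_add[symmetric]) simp
    also have "\<dots> \<le> p ^ (m + 1) * (q ^ (j - (m + 1)) * q ^ (2 * m + 1 - j))"
      using p q by (intro mult_left_mono mult_right_mono power_mono) auto
    also have "\<dots> = p * (p * q) ^ m"
      using j by (simp add: power_mult_distrib flip: power_add)
    finally show ?thesis .
  qed
  have "(1/3 - p) * (2/3 - p) \<ge> 0" using p by (intro mult_nonneg_nonneg) auto
  then have pq: "4 * (p * q) \<le> 8/9" by (simp add: q_def field_simps)
  have "poly (majority_poly m) p
      \<le> (\<Sum>j=m + 1..2 * m + 1. real (2 * m + 1 choose j) * (p * (p * q) ^ m))"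
    unfolding poly_majority_poly q_def[symmetric] by (intro sum_mono mult_left_mono term_bound) auto
  also have "\<dots> \<le> (\<Sum>j\<le>2 * m + 1. real (2 * m + 1 choose j) * (p * (p * q) ^ m))"
    using p q by (intro sum_mono2) auto
  also have "\<dots> = real (\<Sum>j\<le>2 * m + 1. 2 * m + 1 choose j) * (p * (p * q) ^ m)"
    unfolding of_nat_sum by (rule sum_distrib_right[symmetric])
  also have "\<dots> = 2 * p * (4 * (p * q)) ^ m"
    unfolding choose_row_sum by (simp add: power_mult power_mult_distrib)
  also have "\<dots> \<le> 1 * (8/9) ^ m"
    using p q pq by (intro mult_mono power_mono) auto
  finally show "poly (majority_poly m) p \<le> (8/9) ^ m" by simp
qed

lemma sign_approx_majority_poly:
  assumes p: "0 \<le> p" "p \<le> 1"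
  shows "p \<le> 1/3 \<Longrightarrow> \<bar>1 - poly (1 - 2 * majority_poly m) p\<bar> \<le> 2 * (8/9) ^ m"
    and "2/3 \<le> p \<Longrightarrow> \<bar>- 1 - poly (1 - 2 * majority_poly m) p\<bar> \<le> 2 * (8/9) ^ m"
  using poly_majority_poly_bounds[of p m] poly_majority_poly_bounds[of "1 - p" m]
    poly_majority_poly_complement[of m p] p by auto

lemma computes_cases:
  assumes comp: "computes n f P" and f: "boolean_fun n f" and xy: "x < 2 ^ n" "y < 2 ^ n"
  obtains "f x y = 1" "prob_out n P x y True \<le> 1/3" | "f x y = - 1" "2/3 \<le> prob_out n P x y True"
proof -
  have "2/3 \<le> prob_out n P x y (f x y = - 1)" using comp xy by (simp add: computes_def)
  moreover have "f x y = 1 \<or> f x y = - 1" using f xy by (simp add: boolean_fun_def)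
  moreover have "prob_out n P x y False = 1 - prob_out n P x y True"
    using comp prob_out_False by (simp add: computes_def)
  ultimately show thesis using that by auto
qed

lemma rank_le_prob_out:
  assumes "valid_protocol n P"
  shows "rank_le UNIV UNIV (2 * 4 ^ length (rounds P)) (\<lambda>x y. prob_out n P x y True)"
  using rank_le_Re[OF rank_le_expected_output[OF assms, of 1 0]] by simp

lemma approx_rank_le_computes:
  assumes comp: "computes n f P" and f: "boolean_fun n f"
  shows "approx_rank_le n (2 * (8/9) ^ m)
    (Suc (2 * m + 1) * (2 * 4 ^ length (rounds P)) ^ (2 * m + 1)) f"
  unfolding approx_rank_le_def
proof (intro exI conjI allI impI)
  let ?p = "\<lambda>x y. prob_out n P x y True" and ?g = "1 - 2 * majority_poly m"
  have valid: "valid_protocol n P" using comp by (simp add: computes_def)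
  have "degree ?g \<le> 2 * m + 1"
    using degree_majority_poly[of m] by (intro degree_diff_le order_trans[OF degree_mult_le]) auto
  from rank_le_poly[OF rank_le_prob_out[OF valid] _ this]
  show "rank_le {..<2 ^ n} {..<2 ^ n}
      (Suc (2 * m + 1) * (2 * 4 ^ length (rounds P)) ^ (2 * m + 1)) (\<lambda>x y. poly ?g (?p x y))"
    by (rule rank_le_mono) simp_all
  fix x y :: nat assume xy: "x < 2 ^ n" "y < 2 ^ n"
  have "0 \<le> ?p x y" "?p x y \<le> 1"
    using prob_out_nonneg[of n P x y True] prob_out_nonneg[of n P x y False]
      prob_out_False[OF valid, of x y] by linarith+
  then show "\<bar>f x y - poly ?g (?p x y)\<bar> \<le> 2 * (8/9) ^ m"
    using sign_approx_majority_poly[of "?p x y" m]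
    by (cases rule: computes_cases[OF comp f xy]) auto
qed

text \<open>The bias of the output is a nonvanishing real matrix of complex rank one, so its \<open>2 \<times> 2\<close>
  minors vanish, and so do those of its sign \<open>f\<close>.\<close>
lemma rank_le_1_computes_without_rounds:
  assumes comp: "computes n f P" and f: "boolean_fun n f" and no_rounds: "rounds P = []"
  shows "rank_le {..<2 ^ n} {..<2 ^ n} 1 f"
proof -
  have valid: "valid_protocol n P" using comp by (simp add: computes_def)
  define D where "D x y = prob_out n P x y False - prob_out n P x y True" for x y
  have "rank_le UNIV UNIV 1 (\<lambda>x y. complex_of_real (D x y))"
    using rank_le_expected_output[OF valid, of "- 1" 1] no_rounds by (simp add: D_def)
  from rank_le_1_minor[OF this] have minor: "D x y * D x' y' = D x y' * D x' y" for x y x' y'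
    by (simp flip: of_real_mult)
  have sgn_D: "f x y = sgn (D x y) \<and> D x y \<noteq> 0" if "x < 2 ^ n" "y < 2 ^ n" for x y
    by (cases rule: computes_cases[OF comp f that])
      (use prob_out_False[OF valid, of x y] in \<open>auto simp: D_def sgn_if\<close>)
  show ?thesis
  proof (rule rank_le_1I)
    show "f 0 0 \<noteq> 0" using sgn_D[of 0 0] by (simp add: sgn_zero_iff)
    fix x y :: nat assume "x \<in> {..<2 ^ n}" "y \<in> {..<2 ^ n}"
    then show "f x y * f 0 0 = f x 0 * f 0 y"
      using arg_cong[OF minor[of x y 0 0], of sgn] sgn_D by (simp add: sgn_mult)
  qed
qed

section \<open>A protocol for every function\<close>

lemma local_op_all_qubits: "local_op m {..<m} K"
proof -
  have "restr b {..<m} = b" if "b \<in> basis m" for b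
    using that by (auto simp: restr_def basis_eq_basis_on basis_on_def fun_eq_iff)
  moreover have "b i = b' i" if "b \<in> basis m" "b' \<in> basis m" "i \<notin> {..<m}" for b b' i
    using that by (auto simp: basis_eq_basis_on basis_on_def)
  ultimately show ?thesis unfolding local_op_def by (intro exI[of _ K]) simp
qed

definition perm_op :: "((nat \<Rightarrow> bool) \<Rightarrow> nat \<Rightarrow> bool) \<Rightarrow> qop" where
  "perm_op g b b' = (if b = g b' then 1 else 0)"

lemma unitary_perm_op:
  assumes "g ` basis m \<subseteq> basis m" "inj_on g (basis m)"
  shows "unitary_op m (perm_op g)"
  unfolding unitary_op_def
proof (intro ballI)
  fix b1 b2 assume b: "b1 \<in> basis m" "b2 \<in> basis m"
  have "(\<Sum>b\<in>basis m. cnj (perm_op g b b1) * perm_op g b b2)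
      = (\<Sum>b\<in>basis m. if b = g b1 then if b1 = b2 then 1 else 0 else 0)"
    using inj_onD[OF assms(2) _ b] by (intro sum.cong refl) (auto simp: perm_op_def)
  then show "(\<Sum>b\<in>basis m. cnj (perm_op g b b1) * perm_op g b b2) = (if b1 = b2 then 1 else 0)"
    using assms(1) b by (auto simp: finite_basis)
qed

definition basis_state :: "(nat \<Rightarrow> bool) \<Rightarrow> qstate" where
  "basis_state b0 = (\<lambda>b. if b = b0 then 1 else 0)"

lemma init_state_eq_basis_state: "init_state n x y = basis_state (init_basis n x y)"
  by (simp add: init_state_def basis_state_def fun_eq_iff)

lemma apply_perm_op:
  assumes "b0 \<in> basis m"
  shows "apply_op m (perm_op g) (basis_state b0) = basis_state (g b0)"
proof
  fix b
  have "apply_op m (perm_op g) (basis_state b0) b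
      = (\<Sum>b'\<in>basis m. if b' = b0 then perm_op g b b0 else 0)"
    unfolding apply_op_def basis_state_def by (intro sum.cong) auto
  then show "apply_op m (perm_op g) (basis_state b0) b = basis_state (g b0) b"
    using assms by (simp add: finite_basis perm_op_def basis_state_def)
qed

lemma local_op_perm_id: "local_op m S (perm_op id)"
proof -
  have restr: "restr b S = restr b' S \<longleftrightarrow> (\<forall>i\<in>S. b i = b' i)" for b b'
    by (auto simp: restr_def fun_eq_iff)
  have "b = b' \<longleftrightarrow> (\<forall>i. i \<notin> S \<longrightarrow> b i = b' i) \<and> restr b S = restr b' S" for b b'
    unfolding fun_eq_iff[of b b'] restr by blast
  then have "perm_op id b b' =
      (if \<forall>i. i \<notin> S \<longrightarrow> b i = b' i then perm_op id (restr b S) (restr b' S) else 0)" for b b'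
    unfolding perm_op_def id_apply by metis
  then show ?thesis unfolding local_op_def by blast
qed

definition send_all :: "nat list \<Rightarrow> round list" where
  "send_all qs = map (\<lambda>q. (True, perm_op id, q)) qs"

lemma valid_rounds_send_all:
  assumes "distinct qs" "\<forall>q\<in>set qs. q < m \<and> own q"
  shows "valid_rounds m own (send_all qs)"
  using assms
proof (induction qs arbitrary: own)
  case (Cons q qs)
  have "valid_rounds m (own(q := False)) (send_all qs)"
    by (rule Cons.IH) (use Cons.prems in auto)
  then show ?case
    using Cons.prems by (simp add: send_all_def unitary_perm_op local_op_perm_id)
qed (simp add: send_all_def)

lemma final_owner_send_all: "final_owner own (send_all qs) = (\<lambda>i. i \<notin> set qs \<and> own i)"
  by (induction qs arbitrary: own) (auto simp: send_all_def fun_eq_iff)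

lemma evolve_send_all:
  assumes "b0 \<in> basis m"
  shows "evolve m (send_all qs) (basis_state b0) = basis_state b0"
  by (induction qs) (auto simp: send_all_def apply_perm_op[OF assms])

lemma init_basis_inject:
  assumes "x < 2 ^ n" "y < 2 ^ n" "x' < 2 ^ n" "y' < 2 ^ n"
    and eq: "\<forall>i<2 * n. init_basis n x y i = init_basis n x' y' i"
  shows "x = x' \<and> y = y'"
proof
  have "bit x i = bit x' i" "bit y i = bit y' i" if "i < n" for i
    using eq[rule_format, of i] eq[rule_format, of "n + i"] that by (simp_all add: init_basis_def)
  then have "take_bit n x = take_bit n x'" "take_bit n y = take_bit n y'"
    by (auto simp: bit_eq_iff bit_take_bit_iff)
  then show "x = x'" "y = y'" using assms by (simp_all add: take_bit_nat_eq_self)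
qed

definition encodes_minus_one :: "nat \<Rightarrow> (nat \<Rightarrow> nat \<Rightarrow> real) \<Rightarrow> (nat \<Rightarrow> bool) \<Rightarrow> bool" where
  "encodes_minus_one n f b \<longleftrightarrow>
    (\<exists>x<2 ^ n. \<exists>y<2 ^ n. f x y = - 1 \<and> (\<forall>i<2 * n. b i = init_basis n x y i))"

definition flip_output :: "nat \<Rightarrow> (nat \<Rightarrow> nat \<Rightarrow> real) \<Rightarrow> (nat \<Rightarrow> bool) \<Rightarrow> nat \<Rightarrow> bool" where
  "flip_output n f b = b(2 * n := (b (2 * n) \<noteq> encodes_minus_one n f b))"

definition trivial_protocol :: "nat \<Rightarrow> (nat \<Rightarrow> nat \<Rightarrow> real) \<Rightarrow> protocol" where
  "trivial_protocol n f = \<lparr>nqubits = 2 * n + 1, own0 = (\<lambda>i. i < n), rounds = send_all [0..<n],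
    fin_player = False, fin_op = perm_op (flip_output n f), out_qubit = 2 * n\<rparr>"

lemma flip_output_involution: "flip_output n f (flip_output n f b) = b"
proof -
  have "encodes_minus_one n f (flip_output n f b) = encodes_minus_one n f b"
    by (simp add: encodes_minus_one_def flip_output_def)
  then show ?thesis
    by (simp add: flip_output_def[of _ _ "flip_output n f b"]) (auto simp: flip_output_def)
qed

lemma valid_trivial_protocol: "valid_protocol n (trivial_protocol n f)"
proof -
  have "unitary_op (2 * n + 1) (perm_op (flip_output n f))"
  proof (rule unitary_perm_op)
    show "inj_on (flip_output n f) (basis (2 * n + 1))"
      by (rule inj_on_inverseI) (rule flip_output_involution)
  qed (auto simp: flip_output_def basis_def)
  moreover have "valid_rounds (2 * n + 1) (\<lambda>i. i < n) (send_all [0..<n])"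
    by (rule valid_rounds_send_all) auto
  ultimately show ?thesis
    using local_op_all_qubits[of "2 * n + 1"]
    by (simp add: valid_protocol_def trivial_protocol_def final_owner_send_all lessThan_def)
qed

lemma prob_out_trivial_protocol:
  assumes xy: "x < 2 ^ n" "y < 2 ^ n"
  shows "prob_out n (trivial_protocol n f) x y (f x y = - 1) = 1"
proof -
  let ?b = "init_basis n x y" and ?m = "2 * n + 1"
  have b: "?b \<in> basis ?m" by (rule init_basis_in_basis) simp
  have "encodes_minus_one n f ?b \<longleftrightarrow> f x y = - 1"
    unfolding encodes_minus_one_def using init_basis_inject xy by metis
  then have out: "flip_output n f ?b (2 * n) = (f x y = - 1)"
    by (simp add: flip_output_def init_basis_def)
  have "final_state n (trivial_protocol n f) x y = basis_state (flip_output n f ?b)"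
    using evolve_send_all[OF b] apply_perm_op[OF b]
    by (simp add: final_state_def trivial_protocol_def init_state_eq_basis_state)
  moreover have "flip_output n f ?b \<in> basis ?m"
    using b by (auto simp: flip_output_def basis_def)
  ultimately have "prob_out n (trivial_protocol n f) x y (f x y = - 1)
      = (\<Sum>b\<in>basis ?m. if b = flip_output n f ?b then 1 else 0)"
    unfolding prob_out_eq_sum using out
    by (intro sum.cong) (auto simp: trivial_protocol_def basis_state_def)
  then show ?thesis using \<open>flip_output n f ?b \<in> basis ?m\<close> by (simp add: finite_basis)
qed

lemma BQC_attained: obtains P where "computes n f P" "length (rounds P) = BQC n f"
proof -
  have "computes n f (trivial_protocol n f)"
    by (simp add: computes_def valid_trivial_protocol prob_out_trivial_protocol)
  then have "\<exists>c P. computes n f P \<and> length (rounds P) = c" by blast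
  from LeastI_ex[OF this] have "\<exists>P. computes n f P \<and> length (rounds P) = BQC n f"
    unfolding BQC_def .
  then show thesis using that by blast
qed

section \<open>Lower bounds\<close>

lemma approx_rank_le_BQC_0:
  assumes "boolean_fun n f" "BQC n f = 0"
  shows "approx_rank_le n 0 1 f"
proof -
  obtain P where "computes n f P" "length (rounds P) = BQC n f" by (rule BQC_attained)
  then have "rank_le {..<2 ^ n} {..<2 ^ n} 1 f"
    using rank_le_1_computes_without_rounds assms by auto
  then show ?thesis unfolding approx_rank_le_def by (intro exI[of _ f]) simp
qed

lemma amplified_rank_le_power:
  assumes c: "1 \<le> c" and m: "1 \<le> m"
  shows "Suc (2 * m + 1) * (2 * 4 ^ c) ^ (2 * m + 1) \<le> (2::nat) ^ (11 * c * m)"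
proof -
  have "Suc (2 * m + 1) \<le> (2::nat) ^ (2 * m)"
    using m by (induction m rule: dec_induct) auto
  moreover have "(2 * 4 ^ c) ^ (2 * m + 1) = (2::nat) ^ ((2 * c + 1) * (2 * m + 1))"
  proof -
    have "(2 * 4 ^ c :: nat) = 2 ^ (2 * c + 1)" by (simp add: power_mult)
    then show ?thesis by (simp only: power_mult)
  qed
  ultimately have "Suc (2 * m + 1) * (2 * 4 ^ c) ^ (2 * m + 1)
      \<le> (2::nat) ^ (2 * m + (2 * c + 1) * (2 * m + 1))"
    unfolding power_add by (intro mult_le_mono) simp_all
  also have "\<dots> \<le> 2 ^ (11 * c * m)"
  proof (rule power_increasing)
    have "2 * m + (2 * c + 1) * (2 * m + 1) = 4 * (c * m) + 4 * m + 2 * c + 1"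
      by (simp add: algebra_simps)
    moreover have "m \<le> c * m" "c \<le> c * m" using c m by simp_all
    ultimately show "2 * m + (2 * c + 1) * (2 * m + 1) \<le> 11 * c * m"
      unfolding mult.assoc using m by linarith
  qed simp
  finally show ?thesis .
qed

lemma approx_rank_le_BQC:
  assumes f: "boolean_fun n f" and c: "1 \<le> BQC n f" and k: "1 \<le> k"
  shows "approx_rank_le n (2 / 2 ^ k) (2 ^ (66 * BQC n f * k)) f"
proof -
  obtain P where P: "computes n f P" "length (rounds P) = BQC n f" by (rule BQC_attained)
  show ?thesis
  proof (rule approx_rank_le_mono[OF approx_rank_le_computes[OF P(1) f, of "6 * k"]])
    have "(8/9 :: real) ^ (6 * k) \<le> (1/2) ^ k"
      unfolding power_mult by (intro power_mono) (simp_all add: power_divide)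
    then show "2 * (8/9) ^ (6 * k) \<le> (2 / 2 ^ k :: real)" by (simp add: power_divide)
    show "Suc (2 * (6 * k) + 1) * (2 * 4 ^ length (rounds P)) ^ (2 * (6 * k) + 1)
        \<le> 2 ^ (66 * BQC n f * k)"
      using amplified_rank_le_power[OF c, of "6 * k"] k unfolding P(2) by (simp add: mult.assoc)
  qed
qed

lemma entropy_sv_le_BQC_power:
  assumes f: "boolean_fun n f" and c: "1 \<le> BQC n f" and k: "1 \<le> k"
  shows "entropy_sv n f \<le> 66 * (BQC n f * real k) + (n + 2) * (2 / 2 ^ k)\<^sup>2 + 4 * (2 / 2 ^ k)"
  using entropy_sv_le_approx_rank[OF f approx_rank_le_BQC[OF f c k]]
  by (simp add: log_nat_power mult.assoc)

lemma kappa_le_BQC_power: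
  assumes f: "boolean_fun n f" and c: "1 \<le> BQC n f" and j: "1 \<le> j" and k: "k \<le> 2 ^ n"
  shows "kappa n f k \<le> 2 ^ (33 * BQC n f * j) + sqrt k * (2 / 2 ^ j)"
proof -
  have "sqrt (2 ^ (66 * BQC n f * j)) = 2 ^ (33 * BQC n f * j)"
    by (rule real_sqrt_unique) (simp_all flip: power_mult)
  then show ?thesis using kappa_le_approx_rank[OF f k approx_rank_le_BQC[OF f c j]] by simp
qed

lemma entropy_sv_le_BQC:
  assumes f: "boolean_fun n f" and n: "2 \<le> n"
  shows "entropy_sv n f \<le> 140 * BQC n f * log 2 n"
proof (cases "BQC n f = 0")
  case True
  then show ?thesis using entropy_sv_le_approx_rank[OF f approx_rank_le_BQC_0[OF f True]] by simp
next
  case False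
  define k where "k = nat \<lceil>log 2 n\<rceil>"
  have log_n: "1 \<le> log 2 n" using n by (simp add: le_log_iff)
  then have k: "log 2 n \<le> k" "k \<le> 2 * log 2 n" "1 \<le> k"
    unfolding k_def by linarith+
  define e :: real where "e = 2 / 2 ^ k"
  have "real n \<le> 2 ^ k"
    using k(1) n by (simp add: log_le_iff powr_realpow)
  then have e: "0 \<le> e" "e \<le> 2 / n"
    using n by (auto simp: e_def field_simps)
  have "2 / n \<le> 1" using n by simp
  with e have "e \<le> 1" by linarith
  have "n + 2 \<le> 2 * n" "2 * n \<le> n * n" using n by simp_all
  then have n_square: "real n + 2 \<le> real n * real n"
    unfolding of_nat_mult[symmetric] by linarith
  have "(real n + 2) * e\<^sup>2 \<le> (real n + 2) * (2 / n)\<^sup>2"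
    using e by (intro mult_left_mono power_mono) auto
  also have "\<dots> \<le> 4"
    using n n_square by (simp add: field_simps power2_eq_square)
  finally have "entropy_sv n f \<le> 66 * (BQC n f * real k) + 8"
    using entropy_sv_le_BQC_power[OF f _ k(3)] False \<open>e \<le> 1\<close> by (simp flip: e_def)
  also have "\<dots> \<le> 66 * (BQC n f * (2 * log 2 n)) + 8 * (BQC n f * log 2 n)"
  proof (intro add_mono mult_left_mono k)
    show "8 \<le> 8 * (BQC n f * log 2 n)"
      using mult_mono[of 1 "real (BQC n f)" 1 "log 2 n"] False log_n by simp
  qed auto
  finally show ?thesis by simp
qed

lemma log_kappa_le_log_sqrt:
  assumes "boolean_fun n f" "1 \<le> k" "k \<le> 2 ^ n"
  shows "log 2 (kappa n f k) \<le> log 2 (sqrt k)"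
  using kappa_le_sqrt[OF assms(1,3)] kappa_pos[OF assms] assms(2) by simp

lemma log_kappa_le_BQC:
  assumes f: "boolean_fun n f" and k: "1 \<le> k" "k \<le> 2 ^ n"
  shows "log 2 (kappa n f k) \<le> 100 * BQC n f * (log 2 (sqrt k) - log 2 (kappa n f k) + 1)"
proof (cases "BQC n f = 0")
  case True
  have "kappa n f k \<le> 1"
    using kappa_le_approx_rank[OF f k(2) approx_rank_le_BQC_0[OF f True]] by simp
  then show ?thesis using True kappa_pos[OF f k] by simp
next
  case False
  define c \<kappa> where "c = BQC n f" and "\<kappa> = kappa n f k"
  have \<kappa>: "0 < \<kappa>" and sqrt_k: "0 < sqrt k" using kappa_pos[OF f k] k by (simp_all add: \<kappa>_def)
  define L where "L = log 2 (sqrt k) - log 2 \<kappa> + 1"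
  have L: "1 \<le> L" using log_kappa_le_log_sqrt[OF f k] by (simp add: L_def \<kappa>_def)
  define j where "j = nat \<lceil>L + 1\<rceil>"
  have j: "L + 1 \<le> j" "j \<le> 3 * L" "1 \<le> j" using L unfolding j_def by linarith+
  have "4 * sqrt k / \<kappa> = 2 powr (L + 1)"
    using \<kappa> sqrt_k by (simp add: L_def powr_add powr_diff)
  also have "\<dots> \<le> 2 ^ j" using j(1) by (simp flip: powr_realpow)
  finally have "sqrt k * (2 / 2 ^ j) \<le> \<kappa> / 2" using \<kappa> by (simp add: field_simps)
  moreover have "\<kappa> \<le> 2 ^ (33 * c * j) + sqrt k * (2 / 2 ^ j)"
    using kappa_le_BQC_power[OF f _ j(3) k(2)] False by (simp add: \<kappa>_def c_def)
  ultimately have "\<kappa> \<le> 2 ^ (33 * c * j + 1)" by simp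
  then have "log 2 \<kappa> \<le> log 2 (2 ^ (33 * c * j + 1))" using \<kappa> by simp
  also have "\<dots> = 33 * (c * real j) + 1" by (simp only: log_nat_power) simp
  also have "\<dots> \<le> 33 * (c * (3 * L)) + c * L"
  proof (intro add_mono mult_left_mono j)
    show "1 \<le> c * L" using mult_mono[of 1 "real c" 1 L] False L by (simp add: c_def)
  qed auto
  also have "\<dots> = 100 * c * L" by simp
  finally show ?thesis by (simp only: c_def L_def \<kappa>_def)
qed

lemma BQC_ge_entropy:
  assumes "boolean_fun n f" "2 \<le> n"
  shows "1/140 * entropy_sv n f / log 2 n \<le> BQC n f"
  using entropy_sv_le_BQC[OF assms] assms(2) by (simp add: field_simps)

lemma BQC_ge_log_kappa_quotient:
  assumes f: "boolean_fun n f" and k: "1 \<le> k" "k \<le> 2 ^ n"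
  shows "1/100 * (log 2 (kappa n f k) / (log 2 (sqrt k) - log 2 (kappa n f k) + 1)) \<le> BQC n f"
proof -
  have "0 < log 2 (sqrt k) - log 2 (kappa n f k) + 1"
    using log_kappa_le_log_sqrt[OF f k] by linarith
  then show ?thesis using log_kappa_le_BQC[OF f k] by (simp add: field_simps)
qed

lemma BQC_ge_log_kappa:
  assumes f: "boolean_fun n f" and k: "1 \<le> k" "k \<le> 2 ^ n"
    and a: "0 < a" "a * sqrt k \<le> kappa n f k"
  shows "1 / (100 * max 1 (1 - log 2 a)) * log 2 (kappa n f k) \<le> BQC n f"
proof -
  let ?K = "max 1 (1 - log 2 a)"
  have "log 2 a + log 2 (sqrt k) \<le> log 2 (kappa n f k)"
    using log_mono[of 2 "a * sqrt k" "kappa n f k"] a k by (simp add: log_mult)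
  then have "log 2 (sqrt k) - log 2 (kappa n f k) + 1 \<le> ?K" by simp
  then have "log 2 (kappa n f k) \<le> 100 * BQC n f * ?K"
    by (intro order_trans[OF log_kappa_le_BQC[OF f k]] mult_left_mono) auto
  then show ?thesis by (simp add: field_simps less_max_iff_disj)
qed

theorem theorem6p10:
  shows "(\<exists>c>0. \<exists>N. \<forall>n\<ge>N. \<forall>f. boolean_fun n f \<longrightarrow>
            real (BQC n f) \<ge> c * entropy_sv n f / log 2 (real n))
       \<and> (\<forall>a>0. \<exists>c>0. \<exists>N. \<forall>n\<ge>N. \<forall>f k. boolean_fun n f \<and> 1 \<le> k \<and> k \<le> 2^n \<and>
            kappa n f k \<ge> a * sqrt (real k) \<longrightarrow>
            real (BQC n f) \<ge> c * log 2 (kappa n f k))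
       \<and> (\<forall>a>0. \<exists>c>0. \<exists>N. \<forall>n\<ge>N. \<forall>f k. boolean_fun n f \<and> 1 \<le> k \<and> k \<le> 2^n \<and>
            kappa n f k \<le> a * sqrt (real k) \<longrightarrow>
            real (BQC n f) \<ge> c * (log 2 (kappa n f k)
               / (log 2 (sqrt (real k)) - log 2 (kappa n f k) + 1)))"
proof (intro conjI allI impI)
  show "\<exists>c>0. \<exists>N. \<forall>n\<ge>N. \<forall>f. boolean_fun n f \<longrightarrow> real (BQC n f) \<ge> c * entropy_sv n f / log 2 (real n)"
    using BQC_ge_entropy by (intro exI[of _ "1/140"] conjI exI[of _ 2]) auto
next
  fix a :: real assume "a > 0"
  then show "\<exists>c>0. \<exists>N. \<forall>n\<ge>N. \<forall>f k. boolean_fun n f \<and> 1 \<le> k \<and> k \<le> 2^n \<and>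
      kappa n f k \<ge> a * sqrt (real k) \<longrightarrow> real (BQC n f) \<ge> c * log 2 (kappa n f k)"
    using BQC_ge_log_kappa
    by (intro exI[of _ "1 / (100 * max 1 (1 - log 2 a))"] conjI exI[of _ 0]) auto
next
  fix a :: real
  show "\<exists>c>0. \<exists>N. \<forall>n\<ge>N. \<forall>f k. boolean_fun n f \<and> 1 \<le> k \<and> k \<le> 2^n \<and>
      kappa n f k \<le> a * sqrt (real k) \<longrightarrow> real (BQC n f) \<ge> c * (log 2 (kappa n f k)
        / (log 2 (sqrt (real k)) - log 2 (kappa n f k) + 1))"
    using BQC_ge_log_kappa_quotient by (intro exI[of _ "1/100"] conjI exI[of _ 0]) auto
qed

end
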